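(* Let $X$ be a homotopically stratified space and let $X_a$ and $X_b$ be any two distinct strata of $X$. Then the inclusion $\mathrm{hol}(X_b\cup X_a,X_a)\subset \mathrm{pop}(X_b,X,X_a)$ is a special path inclusion. That is, there exists a homotopy $h:\mathrm{pop}(X_b,X,X_a)\times I\to \mathrm{pop}(X_b,X,X_a)$, written $h_s=h(-,s)$ for $s\in I=[0,1]$, such that $h_0=\mathrm{identity}$, each $h_s$ fixes the start and end points of paths, and $\mathrm{image}\{h_s\}\subset \mathrm{hol}(X_b\cup X_a,X_a)$ for all $s\in(0,1]$.
   Context: Filtered space: a topological space $X$ with designated closed subspaces $X^i$ indexed by a finite poset $S_X$ such that $X=\bigcup_{i\in S_X}X^i$ and $X^j\subseteq X^i\Leftrightarrow j\le i$. Put $X_i=X^i-\bigcup_{j<i}X^j$. The strata of $X$ are the path connected components of the $X_i$. If $j<i$, $X_i$ is called a higher stratum than $X_j$, and $X_j$ a lower stratum than $X_i$ (by the usual abuse of notation a stratum is denoted $X_a$, with $a$ used as its index). Popaths: if $W$ is a subspace of a filtered space containing the distinct strata $X_a,X_b$, then $\mathrm{pop}(X_b,W,X_a)$ is the space (with the compact-open topology) of all order preserving paths $\omega:[0,T_\omega]\to W$ with $\omega(0)\in X_a$ and $\omega(T_\omega)\in X_b$. Order preserving means: if $t_1\le t_2$, $\omega(t_1)\in X_j$ and $\omega(t_2)\in X_i$, then $j\le i$. Holink: for a space $S$ and a subspace $Y\subset S$, $\mathrm{hol}(S,Y)$ is the space (with the compact-open topology) of paths $\omega:[0,T_\omega]\to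 S$, $T_\omega>0$, with $\omega(0)\in Y$ and $\omega(t)\in S-Y$ for $t\in(0,T_\omega]$. Thus $\mathrm{hol}(X_b\cup X_a,X_a)$ is the subspace of $\mathrm{pop}(X_b,X,X_a)$ of popaths which immediately leave $X_a$ and travel straight into $X_b$. Path lengths $T_\omega$ may vary (Moore paths); the topology on spaces of such paths is the usual one, obtained by recording $T_\omega$ together with the extension of $\omega$ to $[0,\infty)$ that is constant after $T_\omega$, the latter in the compact-open topology. Tameness: for unions of strata $L\subseteq K$ in $X$, $L$ is tame in $K$ if there are a neighborhood $N$ of $L$ in $K$ and a nearly stratum preserving strong deformation retraction $r$ of $N$ onto $L$ ($r(x,0)=x$, $r(x,1)\in L$, $r(y,t)=y$ for $y\in L$). Nearly stratum preserving means points of $N-L$ remain in the same stratum until the last moment $t=1$, when they are pushed into $L$. Homotopically stratified space: a filtered metric space $X$ such that for every $j<i$, $X_j$ is tame in $X_j\cup X_i$ and the map $\mathrm{hol}(X_i\cup X_j,X_j)\to X_j$ given by evaluation at the start point is a fibration. Special path inclusion: for a path space $B$ and a subspace $A$ of $B$, the inclusion $A\subset B$ is a special path inclusion if there is a homotopy $h:B\times I\to B$ which fixes the start and end points of paths, with $\mathrm{image}\{h_s\}\subset A$ for $s\in(0,1]$ and $h_0=\mathrm{identity}$.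
   Formalization: The sets X_i are additionally assumed pairwise disjoint; without this the inclusion hol ⊂ pop can fail, e.g. for two crossing lines with incomparable indices. *)

theory Defs
  imports "HOL-Analysis.Analysis"
begin

section \<open>Filtered spaces and their strata\<close>

abbreviation unit_interval :: "real topology"
  where "unit_interval \<equiv> top_of_set {0..1}"

text \<open>The filtration is \<open>F i = X\<^sup>i\<close>, indexed by a finite subset \<open>S\<close> of an ordered type;
  \<open>filt_diff S F i\<close> is \<open>X\<^sub>i\<close>.\<close>

definition filt_diff :: "'i::order set \<Rightarrow> ('i \<Rightarrow> 'a set) \<Rightarrow> 'i \<Rightarrow> 'a set"
  where "filt_diff S F i = F i - (\<Union>j\<in>{j\<in>S. j < i}. F j)"

text \<open>The last clause makes explicit that the sets \<open>X\<^sub>i\<close> decompose \<open>X\<close>. It does not follow from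
  the other clauses (take two crossing lines, indexed by two incomparable elements), but the notions
  below presuppose it: they speak of \<^emph>\<open>the\<close> stratum of a point, and a point in two different sets
  \<open>X\<^sub>i\<close> could not lie on any order preserving path.\<close>

definition filtered_space :: "'a topology \<Rightarrow> 'i::order set \<Rightarrow> ('i \<Rightarrow> 'a set) \<Rightarrow> bool"
  where "filtered_space X S F \<longleftrightarrow>
    finite S \<and>
    (\<forall>i\<in>S. closedin X (F i)) \<and>
    topspace X = (\<Union>i\<in>S. F i) \<and>
    (\<forall>i\<in>S. \<forall>j\<in>S. F j \<subseteq> F i \<longleftrightarrow> j \<le> i) \<and>
    (\<forall>i\<in>S. \<forall>j\<in>S. i \<noteq> j \<longrightarrow> filt_diff S F i \<inter> filt_diff S F j = {})"

definition strata :: "'a topology \<Rightarrow> 'i::order set \<Rightarrow> ('i \<Rightarrow> 'a set) \<Rightarrow> 'a set set"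
  where "strata X S F = (\<Union>i\<in>S. path_components_of (subtopology X (filt_diff S F i)))"


section \<open>Spaces of Moore paths\<close>

text \<open>Functions on \<open>topspace X\<close> are represented extensionally; the case \<open>K = {}\<close> shows that the
  carrier of the topology consists of all continuous maps.\<close>

definition compact_open_topology :: "'a topology \<Rightarrow> 'b topology \<Rightarrow> ('a \<Rightarrow> 'b) topology"
  where "compact_open_topology X Y = topology_generated_by
    {{f \<in> extensional (topspace X). continuous_map X Y f \<and> f ` K \<subseteq> U} | K U.
      compactin X K \<and> openin Y U}"

text \<open>A path \<open>\<omega>\<close> on \<open>[0, T]\<close> is encoded as the pair of \<open>T\<close> and the extension of \<open>\<omega>\<close> to \<open>[0, \<infinity>)\<close>
  that is constant from \<open>T\<close> on.\<close>

type_synonym 'a moore_path = "real \<times> (real \<Rightarrow> 'a)"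

abbreviation path_start :: "'a moore_path \<Rightarrow> 'a"
  where "path_start \<omega> \<equiv> snd \<omega> 0"

abbreviation path_end :: "'a moore_path \<Rightarrow> 'a"
  where "path_end \<omega> \<equiv> snd \<omega> (fst \<omega>)"

definition moore_path_space :: "'a topology \<Rightarrow> 'a moore_path topology"
  where "moore_path_space X = subtopology
    (prod_topology (top_of_set {0..}) (compact_open_topology (top_of_set {0..}) X))
    {(T, w). \<forall>t\<ge>T. w t = w T}"

definition order_preserving_path ::
    "'i::order set \<Rightarrow> ('i \<Rightarrow> 'a set) \<Rightarrow> 'a moore_path \<Rightarrow> bool"
  where "order_preserving_path S F \<omega> \<longleftrightarrow>
    (\<forall>t1 t2. \<forall>i\<in>S. \<forall>j\<in>S. 0 \<le> t1 \<and> t1 \<le> t2 \<and> t2 \<le> fst \<omega> \<and>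
      snd \<omega> t1 \<in> filt_diff S F j \<and> snd \<omega> t2 \<in> filt_diff S F i \<longrightarrow> j \<le> i)"

definition pop :: "'a topology \<Rightarrow> 'i::order set \<Rightarrow> ('i \<Rightarrow> 'a set) \<Rightarrow>
    'a set \<Rightarrow> 'a set \<Rightarrow> 'a set \<Rightarrow> 'a moore_path topology"
  where "pop X S F Xb W Xa = subtopology (moore_path_space (subtopology X W))
    {\<omega>. order_preserving_path S F \<omega> \<and> path_start \<omega> \<in> Xa \<and> path_end \<omega> \<in> Xb}"

definition hol :: "'a topology \<Rightarrow> 'a set \<Rightarrow> 'a moore_path topology"
  where "hol X Y = subtopology (moore_path_space X)
    {\<omega>. fst \<omega> > 0 \<and> path_start \<omega> \<in> Y \<and> (\<forall>t\<in>{0<..fst \<omega>}. snd \<omega> t \<in> topspace X - Y)}"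

definition special_path_inclusion :: "'a moore_path topology \<Rightarrow> 'a moore_path topology \<Rightarrow> bool"
  where "special_path_inclusion A B \<longleftrightarrow>
    A = subtopology B (topspace A) \<and>
    (\<exists>h. continuous_map (prod_topology B unit_interval) B h \<and>
         (\<forall>\<omega>\<in>topspace B. h (\<omega>, 0) = \<omega>) \<and>
         (\<forall>\<omega>\<in>topspace B. \<forall>s\<in>{0..1}.
            path_start (h (\<omega>, s)) = path_start \<omega> \<and> path_end (h (\<omega>, s)) = path_end \<omega>) \<and>
         (\<forall>\<omega>\<in>topspace B. \<forall>s\<in>{0<..1}. h (\<omega>, s) \<in> topspace A))"


section \<open>Fibrations\<close>

definition homotopy_lifting_property ::
    "'z topology \<Rightarrow> 'e topology \<Rightarrow> 'b topology \<Rightarrow> ('e \<Rightarrow> 'b) \<Rightarrow> bool"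
  where "homotopy_lifting_property Z E B p \<longleftrightarrow>
    (\<forall>f H. continuous_map Z E f \<and> continuous_map (prod_topology Z unit_interval) B H \<and>
        (\<forall>z\<in>topspace Z. H (z, 0) = p (f z)) \<longrightarrow>
      (\<exists>G. continuous_map (prod_topology Z unit_interval) E G \<and>
        (\<forall>z\<in>topspace Z. G (z, 0) = f z) \<and>
        (\<forall>z\<in>topspace Z. \<forall>t\<in>{0..1}. p (G (z, t)) = H (z, t))))"

text \<open>A definition cannot quantify over the types of the test spaces. The test spaces carried by
  \<open>'e \<times> (real \<Rightarrow> 'b)\<close> include the universal one, which consists of the pairs \<open>(e, \<gamma>)\<close> with
  \<open>\<gamma> 0 = p e\<close>, so this is the homotopy lifting property for all spaces; see
  \<open>fibration_lifting\<close> below.\<close>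

definition fibration :: "'e topology \<Rightarrow> 'b topology \<Rightarrow> ('e \<Rightarrow> 'b) \<Rightarrow> bool"
  where "fibration E B p \<longleftrightarrow> continuous_map E B p \<and>
    (\<forall>Z :: ('e \<times> (real \<Rightarrow> 'b)) topology. homotopy_lifting_property Z E B p)"


section \<open>Homotopically stratified spaces\<close>

definition tame :: "'a topology \<Rightarrow> 'i::order set \<Rightarrow> ('i \<Rightarrow> 'a set) \<Rightarrow> 'a set \<Rightarrow> 'a set \<Rightarrow> bool"
  where "tame X S F L K \<longleftrightarrow>
    (\<exists>N U r. openin (subtopology X K) U \<and> L \<subseteq> U \<and> U \<subseteq> N \<and> N \<subseteq> K \<and>
      continuous_map (prod_topology (subtopology X N) unit_interval) (subtopology X N) r \<and>
      (\<forall>x\<in>N. r (x, 0) = x) \<and>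
      (\<forall>x\<in>N. r (x, 1) \<in> L) \<and>
      (\<forall>y\<in>L. \<forall>t\<in>{0..1}. r (y, t) = y) \<and>
      (\<forall>x\<in>N - L. \<forall>Z\<in>strata X S F. x \<in> Z \<longrightarrow> (\<forall>t\<in>{0..<1}. r (x, t) \<in> Z)))"

definition homotopically_stratified ::
    "'a metric \<Rightarrow> 'i::order set \<Rightarrow> ('i \<Rightarrow> 'a set) \<Rightarrow> bool"
  where "homotopically_stratified M S F \<longleftrightarrow>
    (let X = mtopology_of M in
      filtered_space X S F \<and>
      (\<forall>i\<in>S. \<forall>j\<in>S. j < i \<longrightarrow>
        (let Xi = filt_diff S F i; Xj = filt_diff S F j in
          tame X S F Xj (Xj \<union> Xi) \<and>
          fibration (hol (subtopology X (Xi \<union> Xj)) Xj) (subtopology X Xj) path_start)))"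


section \<open>The lifting property for arbitrary test spaces\<close>

lemma topspace_compact_open_topology:
  "topspace (compact_open_topology X Y) = {f \<in> extensional (topspace X). continuous_map X Y f}"
proof -
  have "{f \<in> extensional (topspace X). continuous_map X Y f}
      \<in> {{f \<in> extensional (topspace X). continuous_map X Y f \<and> f ` K \<subseteq> U} | K U.
          compactin X K \<and> openin Y U}"
    by (rule CollectI, rule exI[of _ "{}"], rule exI[of _ "{}"]) auto
  then show ?thesis
    unfolding compact_open_topology_def topology_generated_by_topspace by blast
qed

lemma openin_compact_open_topology:
  assumes "compactin X K" "openin Y U"
  shows "openin (compact_open_topology X Y)
    {f \<in> extensional (topspace X). continuous_map X Y f \<and> f ` K \<subseteq> U}"
  unfolding compact_open_topology_def
  by (rule topology_generated_by_Basis) (use assms in blast)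

lemma continuous_map_eval_unit_interval:
  "continuous_map (prod_topology (compact_open_topology unit_interval Y) unit_interval) Y
     (\<lambda>(g, t). g t)"
  unfolding continuous_map_eq_topcontinuous_at
proof (intro ballI)
  let ?CI = "prod_topology (compact_open_topology unit_interval Y) unit_interval"
  fix x assume x: "x \<in> topspace ?CI"
  then obtain g t where gt: "x = (g, t)" and g: "g \<in> extensional {0..1}"
      "continuous_map unit_interval Y g" and t: "t \<in> {0..1}"
    by (cases x) (auto simp: topspace_compact_open_topology)
  have "\<exists>W. openin ?CI W \<and> x \<in> W \<and> (\<forall>y\<in>W. (\<lambda>(g, t). g t) y \<in> V)"
    if V: "openin Y V" "g t \<in> V" for V
  proof -
    have "openin unit_interval {u \<in> {0..1}. g u \<in> V}"
      using openin_continuous_map_preimage[OF g(2) V(1)] by simp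
    then obtain Q where Q: "open Q" "{u \<in> {0..1}. g u \<in> V} = {0..1} \<inter> Q"
      by (auto simp: openin_open)
    then have "t \<in> Q" using t V by blast
    then obtain e where e: "e > 0" "cball t e \<subseteq> Q"
      using Q(1) open_contains_cball by blast
    define K where "K = cball t e \<inter> {0..1}"
    have K: "compactin unit_interval K" "g ` K \<subseteq> V"
      using e Q by (auto simp: K_def compactin_subtopology compact_Int)
    define A where
      "A = {f \<in> extensional (topspace unit_interval). continuous_map unit_interval Y f \<and> f ` K \<subseteq> V}"
    have A: "openin (compact_open_topology unit_interval Y) A"
      unfolding A_def by (rule openin_compact_open_topology[OF K(1) V(1)])
    have B: "openin unit_interval (ball t e \<inter> {0..1})"
      by (metis inf_commute open_ball openin_open)
    show ?thesis
    proof (intro exI conjI)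
      show "openin ?CI (A \<times> (ball t e \<inter> {0..1}))"
        using A B by (simp add: openin_prod_Times_iff)
      show "x \<in> A \<times> (ball t e \<inter> {0..1})"
        using g t K(2) e(1) by (auto simp: gt A_def)
      show "\<forall>y\<in>A \<times> (ball t e \<inter> {0..1}). (\<lambda>(g, t). g t) y \<in> V"
        by (auto simp: A_def K_def)
    qed
  qed
  moreover have "(\<lambda>(g, t). g t) \<in> topspace ?CI \<rightarrow> topspace Y"
    by (auto simp: topspace_compact_open_topology continuous_map_def)
  ultimately show "topcontinuous_at ?CI Y (\<lambda>(g, t). g t) x"
    using x unfolding topcontinuous_at_def by (simp add: gt)
qed

lemma continuous_map_curry_unit_interval:
  assumes H: "continuous_map (prod_topology Z unit_interval) Y H"
  shows "continuous_map Z (compact_open_topology unit_interval Y) (\<lambda>z. \<lambda>t\<in>{0..1}. H (z, t))"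
    (is "continuous_map Z _ ?c")
proof -
  have c: "?c z \<in> extensional {0..1}" "continuous_map unit_interval Y (?c z)"
    if "z \<in> topspace Z" for z
  proof -
    have "continuous_map unit_interval (prod_topology Z unit_interval) (\<lambda>t. (z, t))"
      using that by (intro continuous_map_pairedI) auto
    then have "continuous_map unit_interval Y (H \<circ> (\<lambda>t. (z, t)))"
      using H by (rule continuous_map_compose)
    then show "continuous_map unit_interval Y (?c z)"
      by (rule continuous_map_eq) auto
  qed auto
  have "openin Z {z \<in> topspace Z. ?c z ` K \<subseteq> U}"
    if K: "compactin unit_interval K" and U: "openin Y U" for K U
  proof (subst openin_subopen, intro ballI)
    fix z assume z: "z \<in> {z \<in> topspace Z. ?c z ` K \<subseteq> U}"
    define W where "W = {x \<in> topspace (prod_topology Z unit_interval). H x \<in> U}"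
    have W: "openin (prod_topology Z unit_interval) W"
      unfolding W_def by (rule openin_continuous_map_preimage[OF H U])
    have K01: "K \<subseteq> {0..1}"
      using compactin_subset_topspace[OF K] by simp
    have "{z} \<times> K \<subseteq> W"
      using z K01 by (force simp: W_def image_subset_iff)
    then obtain P Q where P: "openin Z P" "z \<in> P" "K \<subseteq> Q" "P \<times> Q \<subseteq> W"
      using tube_lemma_right[OF W K, of z] z by blast
    have "P \<subseteq> {z \<in> topspace Z. ?c z ` K \<subseteq> U}"
    proof
      fix y assume "y \<in> P"
      then have "\<forall>t\<in>K. (y, t) \<in> W" using P by blast
      then show "y \<in> {z \<in> topspace Z. ?c z ` K \<subseteq> U}"
        using \<open>y \<in> P\<close> openin_subset[OF P(1)] K01 by (auto simp: W_def)
    qed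
    with P show "\<exists>T. openin Z T \<and> z \<in> T \<and> T \<subseteq> {z \<in> topspace Z. ?c z ` K \<subseteq> U}"
      by blast
  qed
  moreover have "?c -` {f \<in> extensional (topspace unit_interval). continuous_map unit_interval Y f
      \<and> f ` K \<subseteq> U} \<inter> topspace Z = {z \<in> topspace Z. ?c z ` K \<subseteq> U}" for K U
    using c by auto
  moreover have "?c ` topspace Z \<subseteq> topspace (compact_open_topology unit_interval Y)"
    unfolding topspace_compact_open_topology using c by auto
  ultimately show ?thesis
    unfolding compact_open_topology_def topology_generated_by_topspace
    by (intro continuous_on_generated_topo) auto
qed

lemma fibration_lifting:
  assumes "fibration E B p"
  shows "homotopy_lifting_property Z E B p"
  unfolding homotopy_lifting_property_def
proof (intro allI impI, elim conjE)
  fix f H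
  assume f: "continuous_map Z E f" and H: "continuous_map (prod_topology Z unit_interval) B H"
    and fH: "\<forall>z\<in>topspace Z. H (z, 0) = p (f z)"
  define W where "W = subtopology (prod_topology E (compact_open_topology unit_interval B))
    {(e, g). g 0 = p e}"
  have fst_W: "continuous_map W E fst"
    unfolding W_def by (intro continuous_map_from_subtopology continuous_map_fst)
  have snd_W: "continuous_map W (compact_open_topology unit_interval B) snd"
    unfolding W_def by (intro continuous_map_from_subtopology continuous_map_snd)
  have "continuous_map (prod_topology W unit_interval)
      (prod_topology (compact_open_topology unit_interval B) unit_interval)
      (\<lambda>x. ((snd \<circ> fst) x, snd x))"
    by (intro continuous_map_pairedI continuous_map_compose[OF _ snd_W]
        continuous_map_fst continuous_map_snd)
  from continuous_map_compose[OF this continuous_map_eval_unit_interval]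
  have ev: "continuous_map (prod_topology W unit_interval) B (\<lambda>x. snd (fst x) (snd x))"
    by (simp add: o_def)
  have "homotopy_lifting_property W E B p"
    using assms by (simp add: fibration_def)
  moreover have "\<forall>w\<in>topspace W. snd (fst (w, 0::real)) (snd (w, 0::real)) = p (fst w)"
    by (auto simp: W_def)
  ultimately obtain G where G: "continuous_map (prod_topology W unit_interval) E G"
    "\<forall>w\<in>topspace W. G (w, 0) = fst w"
    "\<forall>w\<in>topspace W. \<forall>t\<in>{0..1}. p (G (w, t)) = snd (fst (w, t)) (snd (w, t))"
    unfolding homotopy_lifting_property_def using fst_W ev by blast
  define c where "c = (\<lambda>z. (f z, \<lambda>t\<in>{0..1}. H (z, t)))"
  have c: "continuous_map Z W c"
    unfolding W_def c_def continuous_map_in_subtopology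
    using f fH continuous_map_curry_unit_interval[OF H]
    by (auto intro: continuous_map_pairedI)
  then have cW: "c z \<in> topspace W" if "z \<in> topspace Z" for z
    using that by (auto simp: continuous_map_def)
  have "continuous_map (prod_topology Z unit_interval) (prod_topology W unit_interval)
      (\<lambda>x. ((c \<circ> fst) x, snd x))"
    by (intro continuous_map_pairedI continuous_map_compose[OF _ c]
        continuous_map_fst continuous_map_snd)
  from continuous_map_compose[OF this G(1)]
  have "continuous_map (prod_topology Z unit_interval) E (\<lambda>x. G (c (fst x), snd x))"
    by (simp add: o_def)
  moreover have "\<forall>z\<in>topspace Z. G (c (fst (z, 0)), snd (z, 0)) = f z"
    using G(2) cW by (simp add: c_def)
  moreover have "\<forall>z\<in>topspace Z. \<forall>t\<in>{0..1}. p (G (c (fst (z, t)), snd (z, t))) = H (z, t)"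
    using G(3) cW by (simp add: c_def)
  ultimately show "\<exists>G. continuous_map (prod_topology Z unit_interval) E G \<and>
      (\<forall>z\<in>topspace Z. G (z, 0) = f z) \<and>
      (\<forall>z\<in>topspace Z. \<forall>t\<in>{0..1}. p (G (z, t)) = H (z, t))"
    by (intro exI conjI)
qed

end

theory Submission
  imports Defs
begin

text \<open>
  An order preserving path from \<open>X\<^sub>a\<close> to \<open>X\<^sub>b\<close> climbs through finitely many strata. It has to be pushed, by an
  arbitrarily small amount, into the top stratum at all positive times, continuously in the path.

  The basic step (\<open>push_off_stratum\<close>) treats two strata \<open>Y\<close> and \<open>Z\<close>, where a path stays in \<open>Y\<close> for a while and
  then moves into \<open>Z\<close>. Tameness gives, for a point of the path shortly after it has left \<open>Y\<close>, a holink path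
  from the retracted point in \<open>Y\<close> to it. Since evaluation at the start point is a fibration, the start point of
  this holink path can be moved back along the retraction of the path. The lifted holink paths may
  be long, but their initial segments are as short as desired and end in \<open>Z\<close>. These end points form the new
  path. Three choices have to depend continuously on the path: how far to look ahead, how far to follow the
  lifted holink path, and where to stop changing the path at all. The first two are exit times of a
  monotone kind (\<open>continuous_exit_time\<close>), which are continuous by construction; the third is built into
  them, since both degenerate in such a way that the construction returns the original point.

  The step works for arbitrary families of paths and with any bound on the displacement, and it may be
  carried out on the part of the domain where the bound is positive. Therefore the intermediate strata
  can be removed one after another (\<open>remove_stratum\<close>): one takes a maximal stratum below the top and lets the
  bound vanish where the path enters a lower stratum. The stratum of the start point is removed last;
  the bound vanishes at time \<open>0\<close>, so that the start point does not move. If the bound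
  moreover is proportional to the homotopy parameter \<open>s\<close>, the pushed paths converge to the original
  ones as \<open>s\<close> tends to \<open>0\<close>, and setting \<open>h\<^sub>0\<close> to the identity gives a continuous homotopy.

  All paths keep their duration, so that continuity in the space of Moore paths reduces, by currying,
  to joint continuity in the path, \<open>s\<close> and the time.
\<close>

section \<open>Continuous choices and lifting up to a variable time\<close>

abbreviation half_line :: "real topology"
  where "half_line \<equiv> top_of_set {0..}"

lemma continuous_map_compose':
  "\<lbrakk>continuous_map Y Z f; continuous_map X Y g\<rbrakk> \<Longrightarrow> continuous_map X Z (\<lambda>x. f (g x))"
  using continuous_map_compose[of X Y g Z f] by (simp add: o_def)

lemma continuous_map_compose_Pair:
  assumes "continuous_map (prod_topology Y Y') Z f" "continuous_map X Y g" "continuous_map X Y' h"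
  shows "continuous_map X Z (\<lambda>x. f (g x, h x))"
  by (rule continuous_map_compose'[OF assms(1)]) (intro continuous_map_pairedI assms)

lemma continuous_map_into_half_line:
  assumes "continuous_map X euclideanreal f" "\<And>x. x \<in> topspace X \<Longrightarrow> 0 \<le> f x"
  shows "continuous_map X half_line f"
  using assms by (auto simp: continuous_map_in_subtopology)

lemma continuous_map_from_half_line:
  assumes "continuous_map X half_line f"
  shows "continuous_map X euclideanreal f"
  using assms by (auto simp: continuous_map_in_subtopology)

lemma INF_attained_unit_interval:
  fixes g :: "real \<Rightarrow> real"
  assumes g: "continuous_map unit_interval euclideanreal g"
  obtains w where "w \<in> {0..1}" "(INF w\<in>{0..1}. g w) = g w" "\<And>v. v \<in> {0..1} \<Longrightarrow> g w \<le> g v"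
proof -
  have "continuous_on {0..1} g"
    using g by simp
  then obtain w where w: "w \<in> {0..1}" "\<forall>v\<in>{0..1}. g w \<le> g v"
    using continuous_attains_inf[of "{0..1::real}" g] by auto
  then have "(INF w\<in>{0..1}. g w) = g w"
    by (intro cInf_eq_minimum) auto
  with w that show thesis by blast
qed

lemma continuous_map_slice:
  assumes "continuous_map (prod_topology P Q) R \<phi>" "p \<in> topspace P"
  shows "continuous_map Q R (\<lambda>w. \<phi> (p, w))"
  by (rule continuous_map_compose_Pair[OF assms(1)]) (use assms(2) in auto)

lemma continuous_map_slice':
  assumes "continuous_map (prod_topology P Q) R \<phi>" "q \<in> topspace Q"
  shows "continuous_map P R (\<lambda>p. \<phi> (p, q))"
  by (rule continuous_map_compose_Pair[OF assms(1)]) (use assms(2) in auto)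

text \<open>The set where the infimum exceeds \<open>a\<close> is open by the tube lemma, because the interval is compact;
  the set where it is below \<open>a\<close> is a union of open sets.\<close>

lemma continuous_map_INF_unit_interval:
  fixes \<phi> :: "'p \<times> real \<Rightarrow> real"
  assumes \<phi>: "continuous_map (prod_topology P unit_interval) euclideanreal \<phi>"
  shows "continuous_map P euclideanreal (\<lambda>p. INF w\<in>{0..1}. \<phi> (p, w))"
  unfolding continuous_map_upper_lower_semicontinuous_lt
proof (intro conjI allI)
  let ?m = "\<lambda>p. INF w\<in>{0..1}. \<phi> (p, w)"
  have att: "\<exists>w\<in>{0..1}. ?m p = \<phi> (p, w) \<and> (\<forall>v\<in>{0..1}. \<phi> (p, w) \<le> \<phi> (p, v))"
    if "p \<in> topspace P" for p
    using INF_attained_unit_interval[OF continuous_map_slice[OF \<phi> that]] by metis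
  show "openin P {p \<in> topspace P. a < ?m p}" for a
  proof (subst openin_subopen, intro ballI)
    fix p assume p: "p \<in> {p \<in> topspace P. a < ?m p}"
    define W where "W = {x \<in> topspace (prod_topology P unit_interval). \<phi> x \<in> {a<..}}"
    have W: "openin (prod_topology P unit_interval) W"
      unfolding W_def by (rule openin_continuous_map_preimage[OF \<phi>]) simp
    have "{p} \<times> {0..1} \<subseteq> W"
      using p att[of p] by (force simp: W_def)
    moreover have "compactin unit_interval {0..1}"
      by (simp add: compactin_subtopology)
    ultimately obtain A B where A: "openin P A" "p \<in> A" "{0..1} \<subseteq> B" "A \<times> B \<subseteq> W"
      using tube_lemma_right[OF W, of "{0..1}" p] p by blast
    have "A \<subseteq> {p \<in> topspace P. a < ?m p}"
    proof
      fix y assume y: "y \<in> A"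
      then have "y \<in> topspace P"
        using A(1) openin_subset by blast
      moreover from att[OF this] obtain w where "w \<in> {0..1}" "?m y = \<phi> (y, w)" by blast
      moreover have "(y, w) \<in> W" if "w \<in> {0..1}" for w
        using y that A by blast
      ultimately show "y \<in> {p \<in> topspace P. a < ?m p}"
        by (simp add: W_def)
    qed
    with A show "\<exists>T. openin P T \<and> p \<in> T \<and> T \<subseteq> {p \<in> topspace P. a < ?m p}" by blast
  qed
  show "openin P {p \<in> topspace P. ?m p < a}" for a
  proof -
    have "{p \<in> topspace P. ?m p < a} = (\<Union>w\<in>{0..1}. {p \<in> topspace P. \<phi> (p, w) \<in> {..<a}})"
    proof (intro equalityI subsetI)
      fix p assume "p \<in> {p \<in> topspace P. ?m p < a}"
      then show "p \<in> (\<Union>w\<in>{0..1}. {p \<in> topspace P. \<phi> (p, w) \<in> {..<a}})"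
        using att[of p] by auto
    next
      fix p assume "p \<in> (\<Union>w\<in>{0..1}. {p \<in> topspace P. \<phi> (p, w) \<in> {..<a}})"
      then obtain v where v: "p \<in> topspace P" "v \<in> {0..1}" "\<phi> (p, v) < a" by auto
      with att[of p] obtain w where "?m p = \<phi> (p, w)" "\<phi> (p, w) \<le> \<phi> (p, v)" by blast
      with v show "p \<in> {p \<in> topspace P. ?m p < a}" by simp
    qed
    moreover have "openin P {p \<in> topspace P. \<phi> (p, w) \<in> {..<a}}" if "w \<in> {0..1}" for w
      by (rule openin_continuous_map_preimage[OF continuous_map_slice'[OF \<phi>]]) (use that in auto)
    ultimately show ?thesis by auto
  qed
qed

text \<open>Because the sign of \<open>\<Psi> (z, u)\<close> tells on which side of the root \<open>u\<close> lies, the sets where the root is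
  above or below \<open>u\<close> are preimages of open rays under the continuous function \<open>\<Psi> (-, u)\<close>. The times
  needed below are chosen continuously by this device, without partitions of unity.\<close>

lemma continuous_root:
  fixes \<Psi> :: "'z \<times> real \<Rightarrow> real"
  assumes \<Psi>: "continuous_map (prod_topology Z half_line) euclideanreal \<Psi>"
    and start: "\<And>z. z \<in> topspace Z \<Longrightarrow> 0 \<le> \<Psi> (z, 0)"
    and stop: "\<And>z. z \<in> topspace Z \<Longrightarrow> \<exists>u\<ge>0. \<Psi> (z, u) < 0"
    and cross: "\<And>z u v. \<lbrakk>z \<in> topspace Z; 0 \<le> u; u < v; \<Psi> (z, u) \<le> 0\<rbrakk> \<Longrightarrow> \<Psi> (z, v) < 0"
  obtains \<rho> where "continuous_map Z half_line \<rho>" "\<And>z. z \<in> topspace Z \<Longrightarrow> \<Psi> (z, \<rho> z) = 0"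
proof -
  have "\<exists>u\<ge>0. \<Psi> (z, u) = 0" if z: "z \<in> topspace Z" for z
  proof -
    obtain v where v: "v \<ge> 0" "\<Psi> (z, v) < 0" using stop[OF z] by blast
    have "continuous_on {0..} (\<lambda>u. \<Psi> (z, u))"
      using continuous_map_slice[OF \<Psi> z] by simp
    then have "continuous_on {0..v} (\<lambda>u. \<Psi> (z, u))"
      by (rule continuous_on_subset) auto
    then show ?thesis
      using IVT2'[of "\<lambda>u. \<Psi> (z, u)" v 0 0] v start[OF z] by auto
  qed
  then obtain \<rho> where \<rho>: "\<And>z. z \<in> topspace Z \<Longrightarrow> \<rho> z \<ge> 0 \<and> \<Psi> (z, \<rho> z) = 0"
    by metis
  have sgn: "(a < \<rho> z \<longleftrightarrow> 0 < \<Psi> (z, a)) \<and> (\<rho> z < a \<longleftrightarrow> \<Psi> (z, a) < 0)"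
    if z: "z \<in> topspace Z" and a: "a \<ge> 0" for z a
  proof (cases a "\<rho> z" rule: linorder_cases)
    case less
    then have "0 < \<Psi> (z, a)" using cross[OF z a less] \<rho>[OF z] by linarith
    with less show ?thesis by linarith
  next
    case equal
    with \<rho>[OF z] show ?thesis by simp
  next
    case greater
    then have "\<Psi> (z, a) < 0" using cross[OF z _ greater] \<rho>[OF z] by linarith
    with greater show ?thesis by linarith
  qed
  have "continuous_map Z euclideanreal \<rho>"
    unfolding continuous_map_upper_lower_semicontinuous_lt
  proof (intro conjI allI)
    fix a
    have *: "openin Z {z \<in> topspace Z. \<Psi> (z, a) \<in> V}" if "open V" "a \<ge> 0" for V
      by (rule openin_continuous_map_preimage[OF continuous_map_slice'[OF \<Psi>]]) (use that in auto)
    show "openin Z {z \<in> topspace Z. a < \<rho> z}"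
    proof (cases "a \<ge> 0")
      case True
      then have "{z \<in> topspace Z. a < \<rho> z} = {z \<in> topspace Z. \<Psi> (z, a) \<in> {0<..}}"
        using sgn by auto
      then show ?thesis using *[of "{0<..}"] True by simp
    next
      case False
      then have "{z \<in> topspace Z. a < \<rho> z} = topspace Z" using \<rho> by force
      then show ?thesis by simp
    qed
    show "openin Z {z \<in> topspace Z. \<rho> z < a}"
    proof (cases "a \<ge> 0")
      case True
      then have "{z \<in> topspace Z. \<rho> z < a} = {z \<in> topspace Z. \<Psi> (z, a) \<in> {..<0}}"
        using sgn by auto
      then show ?thesis using *[of "{..<0}"] True by simp
    next
      case False
      then have "{z \<in> topspace Z. \<rho> z < a} = {}" using \<rho> by force
      then show ?thesis by (metis openin_empty)
    qed
  qed
  then have "continuous_map Z half_line \<rho>"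
    by (rule continuous_map_into_half_line) (use \<rho> in auto)
  with that \<rho> show thesis by blast
qed

text \<open>The homotopy of \<open>z\<close> is followed only up to the time \<open>l z\<close>. The point is the last conclusion: a lifting
  function of a fibration need not lift constant homotopies to constant ones, but where \<open>l\<close> vanishes
  nothing is lifted at all and \<open>f\<close> itself is returned. The running time is rescaled by \<open>1 + l z\<close>, which
  cannot vanish, so that the end time \<open>l z\<close> is reached within the unit interval.\<close>

lemma fibration_lifting_upto:
  assumes fib: "fibration E B p"
    and f: "continuous_map Z E f"
    and l: "continuous_map Z half_line l"
    and H: "continuous_map (prod_topology Z half_line) B H"
    and Hf: "\<And>z. z \<in> topspace Z \<Longrightarrow> H (z, 0) = p (f z)"
  obtains g where "continuous_map Z E g"
    "\<And>z. z \<in> topspace Z \<Longrightarrow> p (g z) = H (z, l z)"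
    "\<And>z. \<lbrakk>z \<in> topspace Z; l z = 0\<rbrakk> \<Longrightarrow> g z = f z"
proof -
  have l0: "l z \<ge> 0" if "z \<in> topspace Z" for z
    using l that by (auto simp: continuous_map_def)
  note lr = continuous_map_from_half_line[OF l]
  define H' where "H' = (\<lambda>x. H (fst x, snd x * (1 + l (fst x))))"
  have "continuous_map (prod_topology Z unit_interval) half_line (\<lambda>x. snd x * (1 + l (fst x)))"
  proof (rule continuous_map_into_half_line)
    show "continuous_map (prod_topology Z unit_interval) euclideanreal (\<lambda>x. snd x * (1 + l (fst x)))"
      by (intro continuous_intros continuous_map_compose'[OF lr] continuous_map_fst
          continuous_map_into_fulltopology[OF continuous_map_snd]) auto
  qed (use l0 in auto)
  then have "continuous_map (prod_topology Z unit_interval) B H'"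
    unfolding H'_def by (intro continuous_map_compose_Pair[OF H] continuous_map_fst)
  moreover have "\<forall>z\<in>topspace Z. H' (z, 0) = p (f z)"
    using Hf by (simp add: H'_def)
  ultimately obtain G where G: "continuous_map (prod_topology Z unit_interval) E G"
      "\<forall>z\<in>topspace Z. G (z, 0) = f z" "\<forall>z\<in>topspace Z. \<forall>t\<in>{0..1}. p (G (z, t)) = H' (z, t)"
    using fibration_lifting[OF fib, of Z] f unfolding homotopy_lifting_property_def by blast
  define v where "v = (\<lambda>z. l z / (1 + l z))"
  have v: "v z \<in> {0..1}" if "z \<in> topspace Z" for z
    using l0[OF that] by (auto simp: v_def)
  have "continuous_map Z euclideanreal v"
    unfolding v_def by (intro continuous_intros lr) (use l0 in force)+
  then have cv: "continuous_map Z unit_interval v"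
    using v by (auto simp: continuous_map_in_subtopology)
  show thesis
  proof
    show "continuous_map Z E (\<lambda>z. G (z, v z))"
      by (rule continuous_map_compose_Pair[OF G(1) _ cv]) simp
    show "p (G (z, v z)) = H (z, l z)" if "z \<in> topspace Z" for z
      using G(3) v[OF that] l0[OF that] that by (simp add: H'_def v_def)
    show "G (z, v z) = f z" if "z \<in> topspace Z" "l z = 0" for z
      using G(2) that by (simp add: v_def)
  qed
qed

section \<open>Controlled modifications of maps into metric spaces\<close>

text \<open>The function is the distance to \<open>C\<close>; for empty \<open>C\<close>, where the infimum is meaningless, it is constant.\<close>

lemma closed_set_is_zero_set:
  assumes C: "closedin (mtopology_of M) C"
  obtains \<delta> :: "'a \<Rightarrow> real" where "continuous_map (mtopology_of M) euclideanreal \<delta>"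
    "\<And>x. 0 \<le> \<delta> x" "\<And>x. x \<in> mspace M \<Longrightarrow> \<delta> x = 0 \<longleftrightarrow> x \<in> C"
proof (cases "C = {}")
  case True
  then show thesis by (intro that[of "\<lambda>x. 1"]) auto
next
  case False
  define \<delta> where "\<delta> = (\<lambda>x. INF y\<in>C. mdist M x y)"
  have CM: "C \<subseteq> mspace M"
    using closedin_subset[OF C] by simp
  have bdd: "bdd_below (mdist M x ` C)" for x
    by (rule bdd_belowI[of _ 0]) auto
  have nonneg: "0 \<le> \<delta> x" for x
    unfolding \<delta>_def by (rule cINF_greatest) (use False in auto)
  have le: "\<delta> x \<le> mdist M x z + \<delta> z" if "x \<in> mspace M" "z \<in> mspace M" for x z
  proof -
    have "\<delta> x - mdist M x z \<le> mdist M z y" if "y \<in> C" for y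
      using cINF_lower[OF bdd that, of x] mdist_triangle[of x M z y] that CM
        \<open>x \<in> mspace M\<close> \<open>z \<in> mspace M\<close>
      by (fastforce simp: \<delta>_def)
    then have "\<delta> x - mdist M x z \<le> \<delta> z"
      unfolding \<delta>_def[of ] by (intro cINF_greatest False) (auto simp: \<delta>_def)
    then show ?thesis by simp
  qed
  have "Lipschitz_continuous_map M euclidean_metric \<delta>"
    unfolding Lipschitz_continuous_map_def
  proof (intro conjI exI ballI)
    fix x y assume "x \<in> mspace M" "y \<in> mspace M"
    then show "mdist euclidean_metric (\<delta> x) (\<delta> y) \<le> 1 * mdist M x y"
      using le[of x y] le[of y x] by (simp add: dist_real_def mdist_commute abs_le_iff)
  qed auto
  then have "continuous_map (mtopology_of M) euclideanreal \<delta>"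
    using Lipschitz_continuous_imp_continuous_map by fastforce
  moreover have "\<delta> x = 0 \<longleftrightarrow> x \<in> C" if x: "x \<in> mspace M" for x
  proof
    assume "x \<in> C"
    then have "\<delta> x \<le> mdist M x x"
      unfolding \<delta>_def by (rule cINF_lower[OF bdd])
    moreover have "mdist M x x = 0" using x by simp
    ultimately show "\<delta> x = 0" using nonneg[of x] by linarith
  next
    assume 0: "\<delta> x = 0"
    show "x \<in> C"
    proof (rule ccontr)
      assume "x \<notin> C"
      interpret Metric_space "mspace M" "mdist M" by simp
      have "closedin mtopology C" using C by (simp add: mtopology_of_def)
      then obtain r where r: "r > 0" "disjnt C (mball x r)"
        using x \<open>x \<notin> C\<close> unfolding closedin_metric by blast
      have "r \<le> mdist M x y" if "y \<in> C" for y
        using r that x CM by (metis disjnt_iff in_mball linorder_not_le subsetD)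
      then have "r \<le> \<delta> x"
        unfolding \<delta>_def by (intro cINF_greatest False)
      with r 0 show False by simp
    qed
  qed
  ultimately show thesis using nonneg that by blast
qed

text \<open>Where \<open>\<kappa>\<close> vanishes \<open>f'\<close> agrees with \<open>f\<close>, and near such a point it differs from \<open>f\<close> arbitrarily little. A family
  of paths that is changed only where a bound is positive is thus continuous across the zeros of the bound.\<close>

lemma continuous_map_controlled_modification:
  assumes f: "continuous_map P (mtopology_of M) f"
    and \<kappa>: "continuous_map P euclideanreal \<kappa>"
    and f': "\<And>p. p \<in> topspace P \<Longrightarrow> f' p \<in> mspace M"
    and d: "\<And>p. p \<in> topspace P \<Longrightarrow> mdist M (f' p) (f p) \<le> \<kappa> p"
    and c: "continuous_map (subtopology P {p. 0 < \<kappa> p}) (mtopology_of M) f'"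
  shows "continuous_map P (mtopology_of M) f'"
proof -
  interpret Metric_space "mspace M" "mdist M" by simp
  have mt: "mtopology_of M = mtopology" by (simp add: mtopology_of_def)
  have E: "openin P {p \<in> topspace P. \<kappa> p \<in> {0<..}}"
    by (rule openin_continuous_map_preimage[OF \<kappa>]) simp
  have fM: "f p \<in> mspace M" if "p \<in> topspace P" for p
    using f that by (auto simp: continuous_map_def)
  show ?thesis
    unfolding mt continuous_map_to_metric
  proof (intro ballI allI impI)
    fix p and \<epsilon> :: real assume p: "p \<in> topspace P" and \<epsilon>: "\<epsilon> > 0"
    show "\<exists>U. openin P U \<and> p \<in> U \<and> (\<forall>y\<in>U. f' y \<in> mball (f' p) \<epsilon>)"
    proof (cases "\<kappa> p > 0")
      case True
      then have "p \<in> topspace (subtopology P {p. 0 < \<kappa> p})" using p by simp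
      with c \<epsilon> obtain U where U: "openin (subtopology P {p. 0 < \<kappa> p}) U" "p \<in> U"
          "\<forall>y\<in>U. f' y \<in> mball (f' p) \<epsilon>"
        unfolding mt continuous_map_to_metric by blast
      from U(1) obtain V where V: "openin P V" "U = V \<inter> {p. 0 < \<kappa> p}"
        by (auto simp: openin_subtopology)
      then have "U = V \<inter> {p \<in> topspace P. \<kappa> p \<in> {0<..}}"
        using openin_subset[of P V] by auto
      then have "openin P U" using openin_Int[OF V(1) E] by simp
      with U show ?thesis by blast
    next
      case False
      with d[OF p] mdist_nonneg[of M "f' p" "f p"] have "mdist M (f' p) (f p) = 0" "\<kappa> p = 0"
        by linarith+
      then have eq: "f' p = f p" using f'[OF p] fM[OF p] by simp
      have "\<epsilon>/2 > 0" using \<epsilon> by simp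
      with f p obtain U where U: "openin P U" "p \<in> U" "\<forall>y\<in>U. f y \<in> mball (f p) (\<epsilon>/2)"
        unfolding mt continuous_map_to_metric by blast
      have V: "openin P {p \<in> topspace P. \<kappa> p \<in> {..<\<epsilon>/2}}"
        by (rule openin_continuous_map_preimage[OF \<kappa>]) simp
      let ?W = "U \<inter> {p \<in> topspace P. \<kappa> p \<in> {..<\<epsilon>/2}}"
      have "f' y \<in> mball (f' p) \<epsilon>" if "y \<in> ?W" for y
      proof -
        have y: "y \<in> topspace P" using that by blast
        have "mdist M (f p) (f' y) \<le> mdist M (f p) (f y) + mdist M (f' y) (f y)"
          using mdist_triangle[of "f p" M "f y" "f' y"] fM[OF p] fM[OF y] f'[OF y]
          by (simp add: mdist_commute)
        also have "\<dots> < \<epsilon>/2 + \<epsilon>/2"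
          using U(3) that d[OF y] by (intro add_strict_mono) auto
        finally show ?thesis using f'[OF y] fM[OF p] by (simp add: eq)
      qed
      moreover have "openin P ?W" "p \<in> ?W"
        using U V p \<epsilon> \<open>\<kappa> p = 0\<close> by auto
      ultimately show ?thesis by blast
    qed
  qed
qed

section \<open>Evaluation and currying for Moore paths\<close>

lemma topspace_moore_path_space:
  "topspace (moore_path_space X) = {(T, w). 0 \<le> T \<and> w \<in> extensional {0..} \<and>
     continuous_map half_line X w \<and> (\<forall>t\<ge>T. w t = w T)}"
  by (auto simp: moore_path_space_def topspace_compact_open_topology)

lemma moore_path_constant_after_end:
  assumes "\<omega> \<in> topspace (moore_path_space X)" "fst \<omega> \<le> t"
  shows "snd \<omega> t = path_end \<omega>"
  using assms unfolding topspace_moore_path_space mem_Collect_eq case_prod_beta by blast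

lemma continuous_map_moore_duration: "continuous_map (moore_path_space X) half_line fst"
  unfolding moore_path_space_def by (intro continuous_map_from_subtopology continuous_map_fst)

text \<open>Every point of the half line has small compact neighbourhoods, and a map that sends one of them into
  an open set keeps this property under small changes in the compact-open topology.\<close>

lemma continuous_map_eval_half_line:
  "continuous_map (prod_topology (compact_open_topology half_line Y) half_line) Y (\<lambda>x. fst x (snd x))"
  unfolding continuous_map_eq_topcontinuous_at
proof (intro ballI)
  let ?CI = "prod_topology (compact_open_topology half_line Y) half_line"
  fix x assume x: "x \<in> topspace ?CI"
  then obtain g t where gt: "x = (g, t)" and g: "g \<in> extensional {0..}"
      "continuous_map half_line Y g" and t: "t \<ge> 0"
    by (cases x) (auto simp: topspace_compact_open_topology)
  have "\<exists>W. openin ?CI W \<and> x \<in> W \<and> (\<forall>y\<in>W. fst y (snd y) \<in> V)"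
    if V: "openin Y V" "g t \<in> V" for V
  proof -
    have "openin half_line {u \<in> {0..}. g u \<in> V}"
      using openin_continuous_map_preimage[OF g(2) V(1)] by simp
    then obtain Q where Q: "open Q" "{u \<in> {0..}. g u \<in> V} = {0..} \<inter> Q"
      by (auto simp: openin_open)
    then have "t \<in> Q" using t V by blast
    then obtain e where e: "e > 0" "cball t e \<subseteq> Q"
      using Q(1) open_contains_cball by blast
    define K where "K = cball t e \<inter> {0..}"
    have K: "compactin half_line K" "g ` K \<subseteq> V"
      using e Q by (auto simp: K_def compactin_subtopology compact_Int_closed)
    define A where
      "A = {f \<in> extensional (topspace half_line). continuous_map half_line Y f \<and> f ` K \<subseteq> V}"
    have A: "openin (compact_open_topology half_line Y) A"
      unfolding A_def by (rule openin_compact_open_topology[OF K(1) V(1)])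
    have B: "openin half_line (ball t e \<inter> {0..})"
      by (metis inf_commute open_ball openin_open)
    show ?thesis
    proof (intro exI conjI)
      show "openin ?CI (A \<times> (ball t e \<inter> {0..}))"
        using A B by (simp add: openin_prod_Times_iff)
      show "x \<in> A \<times> (ball t e \<inter> {0..})"
        using g t K(2) e(1) by (auto simp: gt A_def)
      show "\<forall>y\<in>A \<times> (ball t e \<inter> {0..}). fst y (snd y) \<in> V"
        by (auto simp: A_def K_def)
    qed
  qed
  moreover have "(\<lambda>x. fst x (snd x)) \<in> topspace ?CI \<rightarrow> topspace Y"
    by (auto simp: topspace_compact_open_topology continuous_map_def)
  ultimately show "topcontinuous_at ?CI Y (\<lambda>x. fst x (snd x)) x"
    using x unfolding topcontinuous_at_def by (simp add: gt)
qed

lemma continuous_map_moore_eval: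
  "continuous_map (prod_topology (moore_path_space X) half_line) X (\<lambda>x. snd (fst x) (snd x))"
proof -
  have "continuous_map (moore_path_space X) (compact_open_topology half_line X) snd"
    unfolding moore_path_space_def by (intro continuous_map_from_subtopology continuous_map_snd)
  then have "continuous_map (prod_topology (moore_path_space X) half_line)
      (compact_open_topology half_line X) (\<lambda>x. snd (fst x))"
    by (rule continuous_map_compose'[OF _ continuous_map_fst])
  then show ?thesis
    using continuous_map_compose_Pair[OF continuous_map_eval_half_line _ continuous_map_snd] by simp
qed

lemma continuous_map_curry:
  assumes H: "continuous_map (prod_topology Z A) Y H"
  shows "continuous_map Z (compact_open_topology A Y) (\<lambda>z. \<lambda>t\<in>topspace A. H (z, t))"
    (is "continuous_map Z _ ?c")
proof -
  have c: "?c z \<in> extensional (topspace A)" "continuous_map A Y (?c z)"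
    if "z \<in> topspace Z" for z
  proof -
    show "continuous_map A Y (?c z)"
      using continuous_map_slice[OF H that] by (rule continuous_map_eq) auto
  qed auto
  have "openin Z {z \<in> topspace Z. ?c z ` K \<subseteq> U}"
    if K: "compactin A K" and U: "openin Y U" for K U
  proof (subst openin_subopen, intro ballI)
    fix z assume z: "z \<in> {z \<in> topspace Z. ?c z ` K \<subseteq> U}"
    define W where "W = {x \<in> topspace (prod_topology Z A). H x \<in> U}"
    have W: "openin (prod_topology Z A) W"
      unfolding W_def by (rule openin_continuous_map_preimage[OF H U])
    have KA: "K \<subseteq> topspace A"
      using compactin_subset_topspace[OF K] by simp
    have "{z} \<times> K \<subseteq> W"
      using z KA by (force simp: W_def image_subset_iff)
    then obtain P Q where P: "openin Z P" "z \<in> P" "K \<subseteq> Q" "P \<times> Q \<subseteq> W"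
      using tube_lemma_right[OF W K, of z] z by blast
    have "P \<subseteq> {z \<in> topspace Z. ?c z ` K \<subseteq> U}"
    proof
      fix y assume "y \<in> P"
      then have "\<forall>t\<in>K. (y, t) \<in> W" using P by blast
      then show "y \<in> {z \<in> topspace Z. ?c z ` K \<subseteq> U}"
        using \<open>y \<in> P\<close> openin_subset[OF P(1)] KA by (auto simp: W_def)
    qed
    with P show "\<exists>T. openin Z T \<and> z \<in> T \<and> T \<subseteq> {z \<in> topspace Z. ?c z ` K \<subseteq> U}"
      by blast
  qed
  moreover have "?c -` {f \<in> extensional (topspace A). continuous_map A Y f
      \<and> f ` K \<subseteq> U} \<inter> topspace Z = {z \<in> topspace Z. ?c z ` K \<subseteq> U}" for K U
    using c by auto
  moreover have "?c ` topspace Z \<subseteq> topspace (compact_open_topology A Y)"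
    unfolding topspace_compact_open_topology using c by auto
  ultimately show ?thesis
    unfolding compact_open_topology_def topology_generated_by_topspace
    by (intro continuous_on_generated_topo) auto
qed

lemma continuous_map_into_moore_path_space:
  assumes T: "continuous_map Z half_line T"
    and H: "continuous_map (prod_topology Z half_line) X H"
    and const: "\<And>z t. \<lbrakk>z \<in> topspace Z; T z \<le> t\<rbrakk> \<Longrightarrow> H (z, t) = H (z, T z)"
  shows "continuous_map Z (moore_path_space X) (\<lambda>z. (T z, \<lambda>t\<in>{0..}. H (z, t)))"
proof -
  have T0: "T z \<ge> 0" if "z \<in> topspace Z" for z
    using T that by (auto simp: continuous_map_def)
  have "continuous_map Z (compact_open_topology half_line X) (\<lambda>z. \<lambda>t\<in>{0..}. H (z, t))"
    using continuous_map_curry[OF H] by simp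
  then have "continuous_map Z (prod_topology half_line (compact_open_topology half_line X))
      (\<lambda>z. (T z, \<lambda>t\<in>{0..}. H (z, t)))"
    by (rule continuous_map_pairedI[OF T])
  moreover have "(\<lambda>t\<in>{0..}. H (z, t)) t = (\<lambda>t\<in>{0..}. H (z, t)) (T z)"
    if "z \<in> topspace Z" "t \<ge> T z" for z t
    using const[OF that] T0[OF that(1)] that by simp
  ultimately show ?thesis
    unfolding moore_path_space_def continuous_map_in_subtopology by blast
qed

lemma topology_eq_by_identity:
  assumes "continuous_map X Y id" "continuous_map Y X id"
  shows "X = Y"
proof -
  have sub: "openin B U" if id: "continuous_map B A id" and eq: "topspace A = topspace B"
    and U: "openin A U" for A B :: "'a topology" and U
  proof -
    have "{x \<in> topspace B. id x \<in> U} = U"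
      using openin_subset[OF U] eq by auto
    with openin_continuous_map_preimage[OF id U] show ?thesis by simp
  qed
  have "topspace X = topspace Y"
    using assms by (auto simp: continuous_map_def)
  then show ?thesis
    unfolding topology_eq using sub assms by metis
qed

text \<open>Continuity into a Moore path space can be tested after evaluation, so the identity is continuous in
  both directions.\<close>

lemma moore_path_space_subtopology:
  "moore_path_space (subtopology X W) = subtopology (moore_path_space X) {\<omega>. \<forall>t\<ge>0. snd \<omega> t \<in> W}"
    (is "?A = ?B")
proof (rule topology_eq_by_identity)
  have eq: "(fst \<omega>, \<lambda>t\<in>{0..}. snd \<omega> t) = id \<omega>" if "\<omega> \<in> topspace (moore_path_space Y)"
    for \<omega> and Y :: "'a topology"
    using that by (auto simp: topspace_moore_path_space prod_eq_iff restrict_def extensional_def)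
  have inW: "snd \<omega> t \<in> W" if "\<omega> \<in> topspace ?A" "t \<ge> 0" for \<omega> t
  proof -
    have "continuous_map half_line (subtopology X W) (snd \<omega>)"
      using that(1) unfolding topspace_moore_path_space mem_Collect_eq case_prod_beta by blast
    with that(2) show ?thesis by (auto simp: continuous_map_in_subtopology)
  qed
  have evA: "continuous_map (prod_topology ?A half_line) X (\<lambda>x. snd (fst x) (snd x))"
    using continuous_map_moore_eval[of "subtopology X W"]
    by (rule continuous_map_into_fulltopology)
  have "continuous_map ?A (moore_path_space X) (\<lambda>\<omega>. (fst \<omega>, \<lambda>t\<in>{0..}. snd (fst (\<omega>, t)) (snd (\<omega>, t))))"
    by (rule continuous_map_into_moore_path_space[OF continuous_map_moore_duration evA])
      (unfold fst_conv snd_conv, rule moore_path_constant_after_end)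
  then have "continuous_map ?A (moore_path_space X) id"
    by (rule continuous_map_eq) (use eq in force)
  then show "continuous_map ?A ?B id"
    unfolding continuous_map_in_subtopology using inW by auto
  have "continuous_map ?B (moore_path_space X) (\<lambda>\<omega>. \<omega>)"
    by (rule continuous_map_from_subtopology) simp
  then have "continuous_map (prod_topology ?B half_line) (moore_path_space X) (\<lambda>x. fst x)"
    by (rule continuous_map_compose'[OF _ continuous_map_fst])
  from continuous_map_compose_Pair[OF continuous_map_moore_eval this continuous_map_snd]
  have "continuous_map (prod_topology ?B half_line) X (\<lambda>x. snd (fst x) (snd x))"
    by simp
  then have evB: "continuous_map (prod_topology ?B half_line) (subtopology X W) (\<lambda>x. snd (fst x) (snd x))"
    unfolding continuous_map_in_subtopology by auto
  have "continuous_map ?B half_line fst"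
    by (intro continuous_map_from_subtopology continuous_map_moore_duration)
  then have "continuous_map ?B ?A (\<lambda>\<omega>. (fst \<omega>, \<lambda>t\<in>{0..}. snd (fst (\<omega>, t)) (snd (\<omega>, t))))"
    by (rule continuous_map_into_moore_path_space[OF _ evB])
      (unfold fst_conv snd_conv topspace_subtopology, rule moore_path_constant_after_end, erule IntD1)
  then show "continuous_map ?B ?A id"
    by (rule continuous_map_eq) (use eq in force)
qed

section \<open>Exit times and initial segments of holink paths\<close>

text \<open>\<open>\<sigma> z\<close> is the largest \<open>u\<close> such that \<open>(1 + u) * B \<le> A\<close> on the whole of \<open>[0, u]\<close>. The factor \<open>1 + u\<close> makes it
  continuous: once \<open>B\<close> has become positive the condition gets strictly harder as \<open>u\<close> grows, whereas
  \<open>\<sigma>\<close> passes over every interval on which \<open>B\<close> vanishes, since \<open>A\<close> is positive there.\<close>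

lemma continuous_exit_time:
  fixes A B :: "'z \<times> real \<Rightarrow> real"
  assumes A: "continuous_map (prod_topology Z half_line) euclideanreal A"
    and B: "continuous_map (prod_topology Z half_line) euclideanreal B"
    and B0: "\<And>z v. \<lbrakk>z \<in> topspace Z; 0 \<le> v\<rbrakk> \<Longrightarrow> 0 \<le> B (z, v)"
    and AB: "\<And>z v. \<lbrakk>z \<in> topspace Z; 0 \<le> v; B (z, v) = 0\<rbrakk> \<Longrightarrow> 0 < A (z, v)"
    and start: "\<And>z. z \<in> topspace Z \<Longrightarrow> B (z, 0) \<le> A (z, 0)"
    and stop: "\<And>z. z \<in> topspace Z \<Longrightarrow> \<exists>u v. 0 \<le> v \<and> v \<le> u \<and> A (z, v) < (1 + u) * B (z, v)"
  obtains \<sigma> where "continuous_map Z half_line \<sigma>"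
    "\<And>z v. \<lbrakk>z \<in> topspace Z; 0 \<le> v; v \<le> \<sigma> z\<rbrakk> \<Longrightarrow> (1 + \<sigma> z) * B (z, v) \<le> A (z, v)"
    "\<And>z. z \<in> topspace Z \<Longrightarrow> \<exists>v. 0 \<le> v \<and> v \<le> \<sigma> z \<and> A (z, v) = (1 + \<sigma> z) * B (z, v)"
    "\<And>z u. \<lbrakk>z \<in> topspace Z; 0 \<le> u; \<And>v. \<lbrakk>0 \<le> v; v \<le> u\<rbrakk> \<Longrightarrow> (1 + u) * B (z, v) \<le> A (z, v)\<rbrakk> \<Longrightarrow> u \<le> \<sigma> z"
proof -
  \<comment> \<open>the infimum over \<open>[0, u]\<close>, with the interval rescaled to unit length so that \<open>u\<close> becomes a parameter\<close>
  define \<phi> where "\<phi> = (\<lambda>x. A (fst (fst x), snd x * snd (fst x))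
    - (1 + snd (fst x)) * B (fst (fst x), snd x * snd (fst x)))"
  define \<Psi> where "\<Psi> = (\<lambda>p. INF w\<in>{0..1}. \<phi> (p, w))"
  let ?P = "prod_topology (prod_topology Z half_line) unit_interval"
  have sr: "continuous_map ?P euclideanreal (\<lambda>x. snd (fst x))"
    by (intro continuous_map_compose'[OF continuous_map_into_fulltopology[OF continuous_map_snd] continuous_map_fst])
  have wu: "continuous_map ?P euclideanreal (\<lambda>x. snd x * snd (fst x))"
    by (intro continuous_intros sr continuous_map_into_fulltopology[OF continuous_map_snd])
  then have wu': "continuous_map ?P half_line (\<lambda>x. snd x * snd (fst x))"
    by (rule continuous_map_into_half_line) auto
  have z: "continuous_map ?P Z (\<lambda>x. fst (fst x))"
    by (rule continuous_map_compose'[OF continuous_map_fst continuous_map_fst])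
  have \<phi>: "continuous_map ?P euclideanreal \<phi>"
    unfolding \<phi>_def
    by (intro continuous_intros sr continuous_map_compose_Pair[OF A z wu']
        continuous_map_compose_Pair[OF B z wu']) auto
  have val: "\<phi> ((z, u), w) = A (z, w * u) - (1 + u) * B (z, w * u)" for z u w
    by (simp add: \<phi>_def)
  have att: "\<exists>v. 0 \<le> v \<and> v \<le> u \<and> \<Psi> (z, u) = A (z, v) - (1 + u) * B (z, v)"
    and low: "\<And>v. 0 \<le> v \<Longrightarrow> v \<le> u \<Longrightarrow> \<Psi> (z, u) \<le> A (z, v) - (1 + u) * B (z, v)"
    if z: "z \<in> topspace Z" and u: "0 \<le> u" for z u
  proof -
    have "(z, u) \<in> topspace (prod_topology Z half_line)" using z u by simp
    from INF_attained_unit_interval[OF continuous_map_slice[OF \<phi> this]] obtain w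
      where w: "w \<in> {0..1}" "\<Psi> (z, u) = \<phi> ((z, u), w)" "\<And>v. v \<in> {0..1} \<Longrightarrow> \<phi> ((z, u), w) \<le> \<phi> ((z, u), v)"
      unfolding \<Psi>_def by metis
    have "0 \<le> w * u" "w * u \<le> u" using w u by (auto simp: mult_left_le_one_le)
    with w show "\<exists>v. 0 \<le> v \<and> v \<le> u \<and> \<Psi> (z, u) = A (z, v) - (1 + u) * B (z, v)"
      unfolding val by blast
    show "\<Psi> (z, u) \<le> A (z, v) - (1 + u) * B (z, v)" if v: "0 \<le> v" "v \<le> u" for v
    proof -
      have "v / u \<in> {0..1}" "v / u * u = v" using v u by (auto simp: divide_le_eq_1)
      with w(2) w(3)[of "v / u"] show ?thesis unfolding val by metis
    qed
  qed
  have pos: "0 < B (z, v)" if "z \<in> topspace Z" "0 \<le> v" "0 \<le> u" "A (z, v) \<le> (1 + u) * B (z, v)" for z u v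
    using B0[OF that(1,2)] AB[OF that(1,2)] that by (cases "B (z, v) = 0") auto
  have cross: "\<Psi> (z, v) < 0" if z: "z \<in> topspace Z" and u: "0 \<le> u" "u < v" and le0: "\<Psi> (z, u) \<le> 0" for z u v
  proof -
    obtain x where x: "0 \<le> x" "x \<le> u" "\<Psi> (z, u) = A (z, x) - (1 + u) * B (z, x)"
      using att[OF z u(1)] by blast
    with le0 have le: "A (z, x) \<le> (1 + u) * B (z, x)" by linarith
    then have "0 < B (z, x)" by (rule pos[OF z x(1) u(1)])
    then have "(1 + u) * B (z, x) < (1 + v) * B (z, x)" using u by simp
    moreover have "\<Psi> (z, v) \<le> A (z, x) - (1 + v) * B (z, x)"
      by (rule low) (use z u x in auto)
    ultimately show ?thesis using le by linarith
  qed
  have "continuous_map (prod_topology Z half_line) euclideanreal \<Psi>"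
    unfolding \<Psi>_def by (rule continuous_map_INF_unit_interval[OF \<phi>])
  moreover have "0 \<le> \<Psi> (z, 0)" if z: "z \<in> topspace Z" for z
  proof -
    obtain v where "0 \<le> v" "v \<le> 0" "\<Psi> (z, 0) = A (z, v) - (1 + 0) * B (z, v)"
      using att[OF z order_refl] by blast
    moreover from this(1,2) have "v = 0" by linarith
    ultimately show ?thesis using start[OF z] by simp
  qed
  moreover have "\<exists>u\<ge>0. \<Psi> (z, u) < 0" if z: "z \<in> topspace Z" for z
  proof -
    obtain u v where "0 \<le> v" "v \<le> u" "A (z, v) < (1 + u) * B (z, v)"
      using stop[OF z] by blast
    then show ?thesis using low[OF z, of u v] by (intro exI[of _ u]) linarith
  qed
  ultimately obtain \<sigma> where \<sigma>: "continuous_map Z half_line \<sigma>" "\<And>z. z \<in> topspace Z \<Longrightarrow> \<Psi> (z, \<sigma> z) = 0"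
    using continuous_root[of Z \<Psi>] cross by blast
  have \<sigma>0: "0 \<le> \<sigma> z" if "z \<in> topspace Z" for z
    using \<sigma>(1) that by (auto simp: continuous_map_def)
  show thesis
  proof (rule that[OF \<sigma>(1)])
    fix z assume z: "z \<in> topspace Z"
    show "(1 + \<sigma> z) * B (z, v) \<le> A (z, v)" if "0 \<le> v" "v \<le> \<sigma> z" for v
      using low[OF z \<sigma>0[OF z] that] \<sigma>(2)[OF z] by simp
    show "\<exists>v. 0 \<le> v \<and> v \<le> \<sigma> z \<and> A (z, v) = (1 + \<sigma> z) * B (z, v)"
      using att[OF z \<sigma>0[OF z]] \<sigma>(2)[OF z] by auto
    show "u \<le> \<sigma> z" if u: "0 \<le> u" and le: "\<And>v. \<lbrakk>0 \<le> v; v \<le> u\<rbrakk> \<Longrightarrow> (1 + u) * B (z, v) \<le> A (z, v)" for u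
    proof (rule ccontr)
      assume "\<not> u \<le> \<sigma> z"
      then have "\<Psi> (z, u) < 0" using cross[OF z \<sigma>0[OF z], of u] \<sigma>(2)[OF z] by simp
      moreover obtain x where "0 \<le> x" "x \<le> u" "\<Psi> (z, u) = A (z, x) - (1 + u) * B (z, x)"
        using att[OF z u] by blast
      ultimately show False using le[of x] by simp
    qed
  qed
qed

text \<open>A path in the holink starts in \<open>Y\<close> but lies in \<open>Z\<close> at all later times. Stopping it soon enough gives a
  point of \<open>Z\<close> as near as desired to the start point, and the stopping time can be chosen continuously
  as an exit time for the distance to the start point. The last conclusion says that paths that stay
  close to their start point throughout are not shortened.\<close>

lemma continuous_map_initial_segment_of_holink:
  fixes M :: "'a metric" and E :: "'e topology"
  assumes YZ: "Y \<inter> Z = {}"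
    and L: "continuous_map E (hol (subtopology (mtopology_of M) (Z \<union> Y)) Y) L"
    and \<rho>: "continuous_map E euclideanreal \<rho>"
    and \<rho>0: "\<And>e. e \<in> topspace E \<Longrightarrow> 0 < \<rho> e"
  obtains \<Phi> where "continuous_map E (subtopology (mtopology_of M) Z) \<Phi>"
    "\<And>e. e \<in> topspace E \<Longrightarrow> mdist M (\<Phi> e) (path_start (L e)) \<le> \<rho> e"
    "\<And>e. \<lbrakk>e \<in> topspace E; \<And>t. \<lbrakk>0 \<le> t; t \<le> fst (L e)\<rbrakk> \<Longrightarrow>
        2 * mdist M (snd (L e) t) (path_start (L e)) \<le> \<rho> e\<rbrakk> \<Longrightarrow> \<Phi> e = path_end (L e)"
proof -
  let ?X = "mtopology_of M" and ?W = "subtopology (mtopology_of M) (Z \<union> Y)"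
  have Lm: "continuous_map E (moore_path_space ?W) L"
    using L unfolding hol_def by (rule continuous_map_into_fulltopology)
  have Lh: "0 < fst (L e)" "path_start (L e) \<in> Y"
      "\<And>t. \<lbrakk>0 < t; t \<le> fst (L e)\<rbrakk> \<Longrightarrow> snd (L e) t \<in> topspace ?W - Y" if "e \<in> topspace E" for e
  proof -
    have "L e \<in> topspace (hol ?W Y)"
      using L that by (auto simp: continuous_map_def)
    then show "0 < fst (L e)" "path_start (L e) \<in> Y"
      "\<And>t. \<lbrakk>0 < t; t \<le> fst (L e)\<rbrakk> \<Longrightarrow> snd (L e) t \<in> topspace ?W - Y"
      unfolding hol_def topspace_subtopology by (fastforce simp del: topspace_mtopology_of)+
  qed
  define ev where "ev = (\<lambda>x. snd (L (fst x)) (snd x * fst (L (fst x))))"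
  have dur: "continuous_map E half_line (\<lambda>e. fst (L e))"
    by (rule continuous_map_compose'[OF continuous_map_moore_duration Lm])
  have ev: "continuous_map (prod_topology E half_line) ?W ev"
  proof -
    have "continuous_map (prod_topology E half_line) half_line (\<lambda>x. snd x * fst (L (fst x)))"
    proof (rule continuous_map_into_half_line)
      show "continuous_map (prod_topology E half_line) euclideanreal (\<lambda>x. snd x * fst (L (fst x)))"
        by (intro continuous_intros continuous_map_into_fulltopology[OF continuous_map_snd]
            continuous_map_compose'[OF continuous_map_from_half_line[OF dur] continuous_map_fst])
      show "0 \<le> snd x * fst (L (fst x))" if "x \<in> topspace (prod_topology E half_line)" for x
        using that Lh(1)[of "fst x"] by auto
    qed
    from continuous_map_compose_Pair[OF continuous_map_moore_eval
        continuous_map_compose'[OF Lm continuous_map_fst] this]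
    show ?thesis by (simp add: ev_def)
  qed
  then have evX: "continuous_map (prod_topology E half_line) ?X ev"
    by (rule continuous_map_into_fulltopology)
  have start: "continuous_map E ?X (\<lambda>e. ev (e, 0))"
    by (rule continuous_map_slice'[OF evX]) simp
  have ev0: "ev (e, 0) = path_start (L e)" and ev1: "ev (e, 1) = path_end (L e)" for e
    by (auto simp: ev_def)
  have evZ: "ev (e, v) \<in> Z" if "e \<in> topspace E" "0 < v" "v \<le> 1" for e v
    using Lh(3)[OF that(1), of "v * fst (L e)"] Lh(1)[OF that(1)] that
    by (auto simp: ev_def mult_left_le_one_le)
  have evM: "ev (e, v) \<in> mspace M" if "e \<in> topspace E" "0 \<le> v" for e v
    using evX that by (auto simp: continuous_map_def Pi_iff)
  define A where "A = (\<lambda>x::'e \<times> real. \<rho> (fst x))"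
  define D where "D = (\<lambda>x. mdist M (ev x) (ev (fst x, 0)))"
  have A: "continuous_map (prod_topology E half_line) euclideanreal A"
    unfolding A_def by (rule continuous_map_compose'[OF \<rho> continuous_map_fst])
  have D: "continuous_map (prod_topology E half_line) euclideanreal D"
    unfolding D_def
    by (rule continuous_map_mdist[OF evX]) (rule continuous_map_compose'[OF start continuous_map_fst])
  have D0: "D (e, 0) = 0" if "e \<in> topspace E" for e
  proof -
    have "ev (e, 0) \<in> mspace M" by (rule evM[OF that]) simp
    then show ?thesis by (simp add: D_def)
  qed
  have D1: "0 < D (e, 1)" if "e \<in> topspace E" for e
  proof -
    have "ev (e, 1) \<noteq> ev (e, 0)"
      using evZ[OF that, of 1] Lh(2)[OF that] YZ by (auto simp: ev0)
    then have "D (e, 1) \<noteq> 0"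
      using evM[OF that] by (simp add: D_def)
    then show ?thesis using mdist_nonneg[of M] by (simp add: D_def less_le)
  qed
  obtain \<beta> where \<beta>: "continuous_map E half_line \<beta>"
    "\<And>z v. \<lbrakk>z \<in> topspace E; 0 \<le> v; v \<le> \<beta> z\<rbrakk> \<Longrightarrow> (1 + \<beta> z) * D (z, v) \<le> A (z, v)"
    "\<And>z. z \<in> topspace E \<Longrightarrow> \<exists>v. 0 \<le> v \<and> v \<le> \<beta> z \<and> A (z, v) = (1 + \<beta> z) * D (z, v)"
    "\<And>z u. \<lbrakk>z \<in> topspace E; 0 \<le> u; \<And>v. \<lbrakk>0 \<le> v; v \<le> u\<rbrakk> \<Longrightarrow> (1 + u) * D (z, v) \<le> A (z, v)\<rbrakk> \<Longrightarrow> u \<le> \<beta> z"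
  proof (rule continuous_exit_time[OF A D])
    fix e assume e: "e \<in> topspace E"
    show "D (e, 0) \<le> A (e, 0)"
      using \<rho>0[OF e] D0[OF e] by (simp add: A_def)
    show "\<exists>u v. 0 \<le> v \<and> v \<le> u \<and> A (e, v) < (1 + u) * D (e, v)"
    proof (rule exI[of _ "1 + \<rho> e / D (e, 1)"], rule exI[of _ 1], intro conjI)
      show "1 \<le> 1 + \<rho> e / D (e, 1)" using \<rho>0[OF e] D1[OF e] by simp
      show "A (e, 1) < (1 + (1 + \<rho> e / D (e, 1))) * D (e, 1)"
        using D1[OF e] by (simp add: A_def field_simps)
    qed simp
  qed (use \<rho>0 in \<open>auto simp: A_def D_def\<close>)
  have \<beta>0: "0 < \<beta> e" if e: "e \<in> topspace E" for e
  proof (rule ccontr)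
    assume "\<not> 0 < \<beta> e"
    moreover obtain v where "0 \<le> v" "v \<le> \<beta> e" "A (e, v) = (1 + \<beta> e) * D (e, v)"
      using \<beta>(3)[OF e] by blast
    moreover from calculation have "v = 0" by linarith
    ultimately show False using \<rho>0[OF e] D0[OF e] by (simp add: A_def)
  qed
  define \<epsilon> where "\<epsilon> = (\<lambda>e. min 1 (\<beta> e))"
  have \<epsilon>: "continuous_map E half_line \<epsilon>"
  proof (rule continuous_map_into_half_line)
    show "continuous_map E euclideanreal \<epsilon>"
      unfolding \<epsilon>_def by (intro continuous_intros continuous_map_from_half_line[OF \<beta>(1)]) auto
  qed (use \<beta>0 in \<open>auto simp: \<epsilon>_def intro: less_imp_le\<close>)
  have \<epsilon>01: "0 < \<epsilon> e" "\<epsilon> e \<le> 1" "\<epsilon> e \<le> \<beta> e" if "e \<in> topspace E" for e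
    using \<beta>0[OF that] by (auto simp: \<epsilon>_def)
  show thesis
  proof
    have "continuous_map E ?X (\<lambda>e. ev (e, \<epsilon> e))"
      by (rule continuous_map_compose_Pair[OF evX _ \<epsilon>]) simp
    then show "continuous_map E (subtopology ?X Z) (\<lambda>e. ev (e, \<epsilon> e))"
      unfolding continuous_map_in_subtopology using evZ \<epsilon>01 by auto
    fix e assume e: "e \<in> topspace E"
    have "D (e, \<epsilon> e) \<le> (1 + \<beta> e) * D (e, \<epsilon> e)"
      using \<beta>0[OF e] by (simp add: D_def algebra_simps)
    also have "\<dots> \<le> A (e, \<epsilon> e)"
      using \<beta>(2)[OF e _ \<epsilon>01(3)[OF e]] \<epsilon>01(1)[OF e] by simp
    finally show "mdist M (ev (e, \<epsilon> e)) (path_start (L e)) \<le> \<rho> e"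
      by (simp add: D_def A_def ev0)
    assume small: "\<And>t. \<lbrakk>0 \<le> t; t \<le> fst (L e)\<rbrakk> \<Longrightarrow>
        2 * mdist M (snd (L e) t) (path_start (L e)) \<le> \<rho> e"
    have "1 \<le> \<beta> e"
    proof (rule \<beta>(4)[OF e])
      show "(1 + 1) * D (e, v) \<le> A (e, v)" if "0 \<le> v" "v \<le> 1" for v
        using small[of "v * fst (L e)"] that Lh(1)[OF e]
        by (simp add: D_def A_def ev_def mult_left_le_one_le)
    qed simp
    then show "ev (e, \<epsilon> e) = path_end (L e)"
      using ev1 by (simp add: \<epsilon>_def)
  qed
qed

text \<open>The track of a point under a nearly stratum preserving deformation, run backwards, is a path in the
  holink: it leaves the lower stratum at once and ends in the given point.\<close>

lemma continuous_map_track_in_holink: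
  fixes X :: "'a topology"
  assumes YZ: "Y \<inter> Z = {}" and NW: "N \<subseteq> Y \<union> Z" and NX: "N \<subseteq> topspace X"
    and r: "continuous_map (prod_topology (subtopology X N) unit_interval) (subtopology X N) r"
    and r1: "\<And>x. x \<in> N \<Longrightarrow> r (x, 1) \<in> Y"
    and rZ: "\<And>x t. \<lbrakk>x \<in> N - Y; 0 \<le> t; t < 1\<rbrakk> \<Longrightarrow> r (x, t) \<in> Z"
  shows "continuous_map (subtopology X (N - Y)) (hol (subtopology X (Z \<union> Y)) Y)
    (\<lambda>x. (1, \<lambda>v\<in>{0..}. r (x, 1 - min v 1)))"
proof -
  let ?V = "subtopology X (N - Y)" and ?W = "subtopology X (Z \<union> Y)"
  define H where "H = (\<lambda>x. r (fst x, 1 - min (snd x) 1))"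
  have "continuous_map (prod_topology ?V half_line) euclideanreal (\<lambda>x. 1 - min (snd x) 1)"
    by (intro continuous_intros continuous_map_into_fulltopology[OF continuous_map_snd]) auto
  then have s: "continuous_map (prod_topology ?V half_line) unit_interval (\<lambda>x. 1 - min (snd x) 1)"
    by (auto simp: continuous_map_in_subtopology)
  have "continuous_map ?V (subtopology X N) (\<lambda>x. x)"
    by (auto simp: continuous_map_in_subtopology intro: continuous_map_from_subtopology)
  then have "continuous_map (prod_topology ?V half_line) (subtopology X N) fst"
    by (rule continuous_map_compose'[OF _ continuous_map_fst])
  from continuous_map_compose_Pair[OF r this s]
  have H0: "continuous_map (prod_topology ?V half_line) (subtopology X N) H"
    by (simp add: H_def)
  then have HW: "continuous_map (prod_topology ?V half_line) ?W H"
    by (rule continuous_map_into_subtopology[OF continuous_map_into_fulltopology])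
      (use H0 NW in \<open>auto simp: continuous_map_in_subtopology Pi_iff\<close>)
  have "continuous_map ?V half_line (\<lambda>x. 1)" by simp
  from continuous_map_into_moore_path_space[OF this HW]
  have m: "continuous_map ?V (moore_path_space ?W) (\<lambda>x. (1, \<lambda>v\<in>{0..}. H (x, v)))"
    by (simp add: H_def)
  have "r (x, 1 - t) \<in> topspace X" "r (x, 1 - t) \<in> Z" "r (x, 1 - t) \<notin> Y"
    if "x \<in> N - Y" "0 < t" "t \<le> 1" for x t
  proof -
    show "r (x, 1 - t) \<in> Z" using rZ[OF that(1), of "1 - t"] that by simp
    then show "r (x, 1 - t) \<notin> Y" using YZ by blast
    have "(x, 1 - t) \<in> topspace (prod_topology (subtopology X N) unit_interval)"
      using that NX by auto
    then show "r (x, 1 - t) \<in> topspace X"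
      using r by (force simp: continuous_map_def Pi_iff)
  qed
  then show ?thesis
    using m r1 unfolding hol_def continuous_map_in_subtopology H_def
    by (auto simp: image_subset_iff)
qed

section \<open>Pushing a family of paths off one stratum\<close>

text \<open>Here \<open>Y\<close> is a lower and \<open>Z\<close> a higher stratum, and \<open>r\<close> deforms the neighbourhood \<open>N\<close> of \<open>Y\<close> in \<open>Y \<union> Z\<close> into
  \<open>Y\<close>. Write \<open>\<gamma> (\<omega>, t)\<close> for the point \<open>r (f (\<omega>, t), 1)\<close> of \<open>Y\<close>. To find a point of \<open>Z\<close> near a point \<open>f (\<omega>, t)\<close> of \<open>Y\<close>,
  look ahead to a time \<open>t + \<sigma>\<close> at which the path has just left \<open>Y\<close>. The deformation track of \<open>f (\<omega>, t + \<sigma>)\<close>,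
  run backwards, is a holink path that starts at \<open>\<gamma> (\<omega>, t + \<sigma>)\<close>. The fibration property moves its start
  point back along \<open>\<gamma>\<close> to \<open>\<gamma> (\<omega>, t)\<close>. This distorts the rest of the path in an uncontrolled way, but a
  sufficiently short initial segment of it ends in \<open>Z\<close> close to \<open>\<gamma> (\<omega>, t)\<close>, hence close to \<open>f (\<omega>, t)\<close>.

  The time at which a path leaves \<open>Y\<close> is not a continuous function of the path, and \<open>\<kappa>\<close> may vanish for
  small \<open>t\<close>, so the look-ahead cannot start from one time for the whole path. It is chosen anew at every
  \<open>(\<omega>, t)\<close>: it is \<open>0\<close>, and the track is not shortened, as soon as \<open>f (\<omega>, t)\<close> is far enough from \<open>Y\<close>, and there
  the construction returns \<open>f (\<omega>, t)\<close> itself.\<close>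

lemma push_off_stratum:
  fixes M :: "'a metric" and \<Omega> :: "'z topology" and f :: "'z \<times> real \<Rightarrow> 'a"
  assumes YZ: "Y \<inter> Z = {}" and YZM: "Y \<union> Z \<subseteq> mspace M"
    and C: "closedin (mtopology_of M) C" "C \<inter> (Y \<union> Z) = Y"
    and U: "openin (subtopology (mtopology_of M) (Y \<union> Z)) U" "Y \<subseteq> U" "U \<subseteq> N"
    and N: "N \<subseteq> Y \<union> Z"
    and r: "continuous_map (prod_topology (subtopology (mtopology_of M) N) unit_interval)
        (subtopology (mtopology_of M) N) r"
    and r0: "\<And>x. x \<in> N \<Longrightarrow> r (x, 0) = x"
    and r1: "\<And>x. x \<in> N \<Longrightarrow> r (x, 1) \<in> Y"
    and rY: "\<And>y t. \<lbrakk>y \<in> Y; 0 \<le> t; t \<le> 1\<rbrakk> \<Longrightarrow> r (y, t) = y"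
    and rZ: "\<And>x t. \<lbrakk>x \<in> N - Y; 0 \<le> t; t < 1\<rbrakk> \<Longrightarrow> r (x, t) \<in> Z"
    and fib: "fibration (hol (subtopology (mtopology_of M) (Z \<union> Y)) Y)
        (subtopology (mtopology_of M) Y) path_start"
    and f: "continuous_map (prod_topology \<Omega> half_line) (mtopology_of M) f"
    and T: "continuous_map \<Omega> euclideanreal T"
    and \<kappa>: "continuous_map (prod_topology \<Omega> half_line) euclideanreal \<kappa>"
    and \<kappa>0: "\<And>\<omega> t. \<lbrakk>\<omega> \<in> topspace \<Omega>; 0 \<le> t\<rbrakk> \<Longrightarrow> 0 \<le> \<kappa> (\<omega>, t)"
    and \<kappa>_persists: "\<And>\<omega> t u. \<lbrakk>\<omega> \<in> topspace \<Omega>; 0 \<le> t; t \<le> u; 0 < \<kappa> (\<omega>, t)\<rbrakk> \<Longrightarrow> 0 < \<kappa> (\<omega>, u)"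
    and f_YZ: "\<And>\<omega> t. \<lbrakk>\<omega> \<in> topspace \<Omega>; 0 \<le> t; 0 < \<kappa> (\<omega>, t)\<rbrakk> \<Longrightarrow> f (\<omega>, t) \<in> Y \<union> Z"
    and stay: "\<And>\<omega> t u. \<lbrakk>\<omega> \<in> topspace \<Omega>; 0 \<le> t; t \<le> u; 0 < \<kappa> (\<omega>, t); f (\<omega>, t) \<in> Z\<rbrakk>
        \<Longrightarrow> f (\<omega>, u) \<in> Z"
    and endZ: "\<And>\<omega> t. \<lbrakk>\<omega> \<in> topspace \<Omega>; 0 \<le> t; T \<omega> \<le> t; 0 < \<kappa> (\<omega>, t)\<rbrakk> \<Longrightarrow> f (\<omega>, t) \<in> Z"
  obtains f' where "continuous_map (prod_topology \<Omega> half_line) (mtopology_of M) f'"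
    "\<And>\<omega> t. \<lbrakk>\<omega> \<in> topspace \<Omega>; 0 \<le> t\<rbrakk> \<Longrightarrow> mdist M (f' (\<omega>, t)) (f (\<omega>, t)) \<le> \<kappa> (\<omega>, t)"
    "\<And>\<omega> t. \<lbrakk>\<omega> \<in> topspace \<Omega>; 0 \<le> t; 0 < \<kappa> (\<omega>, t)\<rbrakk> \<Longrightarrow> f' (\<omega>, t) \<in> Z"
    "\<And>\<omega> t. \<lbrakk>\<omega> \<in> topspace \<Omega>; 0 \<le> t; T \<omega> \<le> t\<rbrakk> \<Longrightarrow> f' (\<omega>, t) = f (\<omega>, t)"
proof -
  let ?X = "mtopology_of M" and ?P = "prod_topology \<Omega> half_line"
  define E where "E = subtopology ?P {e. 0 < \<kappa> e}"
  have inE: "e \<in> topspace E \<longleftrightarrow> fst e \<in> topspace \<Omega> \<and> 0 \<le> snd e \<and> 0 < \<kappa> e" for e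
    by (cases e) (auto simp: E_def)
  have f_in: "f e \<in> Y \<union> Z" if "e \<in> topspace E" for e
    using f_YZ[of "fst e" "snd e"] that by (simp add: inE)
  have fE: "continuous_map E (subtopology ?X (Y \<union> Z)) f"
    unfolding continuous_map_in_subtopology
    using f_in by (auto simp: E_def intro: continuous_map_from_subtopology f)
  have fEX: "continuous_map E ?X f"
    using fE by (rule continuous_map_into_fulltopology)
  define later where "later = (\<lambda>x::('z \<times> real) \<times> real. (fst (fst x), snd (fst x) + snd x))"
  have laterE: "later (e, v) \<in> topspace E" if "e \<in> topspace E" "0 \<le> v" for e v
    using \<kappa>_persists[of "fst e" "snd e" "snd e + v"] that by (simp add: inE later_def)
  have later0: "later (e, 0) = e" for e by (simp add: later_def)
  have later: "continuous_map Q E (\<lambda>x. later (a x, b x))"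
    if a: "continuous_map Q E a" and b: "continuous_map Q half_line b" for Q a b
  proof -
    have aP: "continuous_map Q ?P a"
      using a unfolding E_def by (rule continuous_map_into_fulltopology)
    have aE: "a x \<in> topspace E" "0 \<le> b x" if "x \<in> topspace Q" for x
      using a b that by (auto simp: continuous_map_def)
    have "continuous_map Q half_line (\<lambda>x. snd (a x) + b x)"
    proof (rule continuous_map_into_half_line)
      show "continuous_map Q euclideanreal (\<lambda>x. snd (a x) + b x)"
        by (intro continuous_map_add continuous_map_from_half_line[OF b]
            continuous_map_from_half_line[OF continuous_map_compose'[OF continuous_map_snd aP]])
    qed (use aE inE in auto)
    then have "continuous_map Q ?P (\<lambda>x. later (a x, b x))"
      unfolding later_def fst_conv snd_conv
      by (intro continuous_map_pairedI continuous_map_compose'[OF continuous_map_fst aP])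
    then show ?thesis
      unfolding E_def continuous_map_in_subtopology using laterE aE inE by auto
  qed
  \<comment> \<open>\<open>g\<close> measures the distance from \<open>Y\<close>\<close>
  obtain \<delta>C where \<delta>C: "continuous_map ?X euclideanreal \<delta>C" "\<And>x. 0 \<le> \<delta>C x"
      "\<And>x. x \<in> mspace M \<Longrightarrow> \<delta>C x = 0 \<longleftrightarrow> x \<in> C"
    using closed_set_is_zero_set[OF C(1)] by blast
  define g where "g = (\<lambda>e. \<delta>C (f e))"
  have g: "continuous_map E euclideanreal g"
    unfolding g_def by (rule continuous_map_compose'[OF \<delta>C(1) fEX])
  have g0: "0 \<le> g e" for e by (simp add: g_def \<delta>C(2))
  have gY: "g e = 0 \<longleftrightarrow> f e \<in> Y" if "e \<in> topspace E" for e
    using f_in[OF that] YZM C(2) \<delta>C(3)[of "f e"] by (auto simp: g_def)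
  obtain V where V: "openin ?X V" "U = V \<inter> (Y \<union> Z)"
    using U(1) by (auto simp: openin_subtopology)
  have "closedin ?X (topspace ?X - V)" using V(1) by blast
  from closed_set_is_zero_set[OF this]
  obtain \<delta>U where \<delta>U: "continuous_map ?X euclideanreal \<delta>U" "\<And>x. 0 \<le> \<delta>U x"
      "\<And>x. x \<in> mspace M \<Longrightarrow> \<delta>U x = 0 \<longleftrightarrow> x \<in> topspace ?X - V"
    by blast
  have \<delta>U_pos: "0 < \<delta>U (f e) \<longleftrightarrow> f e \<in> U" if "e \<in> topspace E" for e
    using f_in[OF that] YZM \<delta>U(2)[of "f e"] \<delta>U(3)[of "f e"] V(2) by (auto simp: less_le)
  \<comment> \<open>\<open>\<theta>\<close> bounds the size of the deformation track of a point; the signs turn an infimum into a supremum\<close>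
  define \<theta> where "\<theta> = (\<lambda>x. - (INF v\<in>{0..1}. - mdist M (r (x, v)) (r (x, 1))))"
  have topN: "topspace (subtopology ?X N) = N" using N YZM by auto
  have track: "continuous_map (prod_topology (subtopology ?X N) unit_interval) euclideanreal
      (\<lambda>x. - mdist M (r x) (r (fst x, 1)))"
  proof -
    have rX: "continuous_map (prod_topology (subtopology ?X N) unit_interval) ?X r"
      using r by (rule continuous_map_into_fulltopology)
    have "continuous_map (subtopology ?X N) ?X (\<lambda>x. r (x, 1))"
      by (rule continuous_map_slice'[OF rX]) simp
    then show ?thesis
      by (intro continuous_map_minus continuous_map_mdist[OF rX]
          continuous_map_compose'[OF _ continuous_map_fst])
  qed
  have \<theta>: "continuous_map (subtopology ?X N) euclideanreal \<theta>"
    unfolding \<theta>_def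
    using continuous_map_minus[OF continuous_map_INF_unit_interval[OF track]] by simp
  have \<theta>_att: "\<exists>w\<in>{0..1}. \<theta> x = mdist M (r (x, w)) (r (x, 1)) \<and>
      (\<forall>v\<in>{0..1}. mdist M (r (x, v)) (r (x, 1)) \<le> \<theta> x)" if "x \<in> N" for x
  proof -
    have "x \<in> topspace (subtopology ?X N)" using that topN by simp
    from INF_attained_unit_interval[OF continuous_map_slice[OF track this]]
    obtain w where w: "w \<in> {0..1}"
      "(INF v\<in>{0..1}. - mdist M (r (x, v)) (r (fst (x, v), 1))) = - mdist M (r (x, w)) (r (fst (x, w), 1))"
      "\<And>v. v \<in> {0..1} \<Longrightarrow>
        - mdist M (r (x, w)) (r (fst (x, w), 1)) \<le> - mdist M (r (x, v)) (r (fst (x, v), 1))"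
      by blast
    then have "\<theta> x = mdist M (r (x, w)) (r (x, 1))" by (simp add: \<theta>_def)
    with w show ?thesis by (intro bexI[of _ w]) auto
  qed
  have \<theta>_le: "mdist M (r (x, v)) (r (x, 1)) \<le> \<theta> x" if "x \<in> N" "0 \<le> v" "v \<le> 1" for x v
    using \<theta>_att[OF that(1)] that by auto
  have \<theta>Y: "\<theta> y = 0" if "y \<in> Y" for y
  proof -
    have "y \<in> N" "y \<in> mspace M" using that U YZM by auto
    then show ?thesis using \<theta>_att[of y] rY[OF that] by auto
  qed
  \<comment> \<open>\<open>q > 0\<close> permits pushing: the point lies in the given neighbourhood of \<open>Y\<close>, its track is short
    compared with \<open>\<kappa>\<close>, and the path has not reached its end, where it must not be changed\<close>
  define b where "b = (\<lambda>e. min (T (fst e) - snd e) (min (\<delta>U (f e)) (\<kappa> e / 2 - 2 * \<theta> (f e))))"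
  define q where "q = (\<lambda>e. if f e \<in> U then max 0 (b e) else 0)"
  have q: "continuous_map E euclideanreal q"
  proof -
    let ?E = "subtopology E {e. 0 < \<delta>U (f e)}"
    have idE: "continuous_map ?E ?P (\<lambda>e. e)"
      unfolding E_def by (intro continuous_map_from_subtopology) simp
    have "continuous_map ?E (subtopology ?X N) f"
      unfolding continuous_map_in_subtopology
      using \<delta>U_pos U(3) by (auto intro: continuous_map_from_subtopology fEX)
    then have "continuous_map ?E euclideanreal (\<lambda>e. \<theta> (f e))"
      by (rule continuous_map_compose'[OF \<theta>])
    moreover have "continuous_map ?E euclideanreal (\<lambda>e. \<delta>U (f e))"
      by (intro continuous_map_compose'[OF \<delta>U(1)] continuous_map_from_subtopology fEX)
    moreover have "continuous_map ?E euclideanreal (\<lambda>e. T (fst e))"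
      by (intro continuous_map_compose'[OF T] continuous_map_compose'[OF continuous_map_fst idE])
    moreover have "continuous_map ?E euclideanreal (\<lambda>e. snd e)"
      by (intro continuous_map_from_half_line continuous_map_compose'[OF continuous_map_snd idE])
    moreover have "continuous_map ?E euclideanreal \<kappa>"
      using continuous_map_compose'[OF \<kappa> idE] by simp
    ultimately have "continuous_map ?E euclideanreal (\<lambda>e. max 0 (b e))"
      unfolding b_def by (intro continuous_intros) auto
    then have "continuous_map ?E euclideanreal q"
      by (rule continuous_map_eq) (use \<delta>U_pos in \<open>auto simp: q_def\<close>)
    then have qE: "continuous_map ?E (mtopology_of euclidean_metric) q" by simp
    have "continuous_map E (mtopology_of euclidean_metric) q"
    proof (rule continuous_map_controlled_modification[OF _ _ _ _ qE])
      show "continuous_map E (mtopology_of euclidean_metric) (\<lambda>e. 0)" by simp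
      show "continuous_map E euclideanreal (\<lambda>e. \<delta>U (f e))"
        by (rule continuous_map_compose'[OF \<delta>U(1) fEX])
      show "mdist euclidean_metric (q e) 0 \<le> \<delta>U (f e)" for e
        using \<delta>U(2)[of "f e"] by (auto simp: q_def b_def min_le_iff_disj)
    qed simp
    then show ?thesis by simp
  qed
  have q0: "0 \<le> q e" for e by (simp add: q_def)
  have q_pos: "f e \<in> U" "snd e < T (fst e)" "4 * \<theta> (f e) \<le> \<kappa> e" if "0 < q e" for e
    using that by (auto simp: q_def b_def split: if_splits)
  have qY: "0 < q e" if e: "e \<in> topspace E" and "f e \<in> Y" for e
  proof -
    have "f e \<in> U" "\<theta> (f e) = 0" using that U \<theta>Y by auto
    moreover have "snd e < T (fst e)"
      using endZ[of "fst e" "snd e"] that YZ by (fastforce simp: inE)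
    ultimately show ?thesis
      using \<delta>U_pos[OF e] e by (simp add: q_def b_def inE)
  qed
  \<comment> \<open>Points are moved only where \<open>g \<le> q\<close>. This region contains all points over \<open>Y\<close>, and it is closed, so
    that the result can be pasted to \<open>f\<close> along \<open>g = q\<close>.\<close>
  define E1 where "E1 = subtopology E {e. g e \<le> q e}"
  have E1: "e \<in> topspace E" "0 < q e" "g e \<le> q e" if "e \<in> topspace E1" for e
  proof -
    show 1: "e \<in> topspace E" "g e \<le> q e" using that by (auto simp: E1_def)
    show "0 < q e"
      using qY[OF 1(1)] gY[OF 1(1)] 1(2) g0[of e] q0[of e] by linarith
  qed
  have idE1: "continuous_map E1 E (\<lambda>e. e)"
    unfolding E1_def by (intro continuous_map_from_subtopology) simp
  \<comment> \<open>The look-ahead time is an exit time: on \<open>[0, \<sigma> e]\<close> pushing stays permitted, and at \<open>\<sigma> e\<close> the path has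
    left \<open>Y\<close>, because equality of \<open>q\<close> with a multiple of \<open>g\<close> is impossible over \<open>Y\<close>.\<close>
  have laterE1: "continuous_map (prod_topology E1 half_line) E (\<lambda>x. later x)"
    using later[OF continuous_map_compose'[OF idE1 continuous_map_fst] continuous_map_snd] by simp
  obtain \<sigma> where \<sigma>: "continuous_map E1 half_line \<sigma>"
    and \<sigma>_le: "\<And>e v. \<lbrakk>e \<in> topspace E1; 0 \<le> v; v \<le> \<sigma> e\<rbrakk>
        \<Longrightarrow> (1 + \<sigma> e) * g (later (e, v)) \<le> q (later (e, v))"
    and \<sigma>_eq: "\<And>e. e \<in> topspace E1 \<Longrightarrow>
        \<exists>v. 0 \<le> v \<and> v \<le> \<sigma> e \<and> q (later (e, v)) = (1 + \<sigma> e) * g (later (e, v))"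
  proof (rule continuous_exit_time[OF continuous_map_compose'[OF q laterE1] continuous_map_compose'[OF g laterE1]])
    fix e assume e: "e \<in> topspace E1"
    show "0 < q (later (e, v))" if "0 \<le> v" "g (later (e, v)) = 0" for v
      using qY gY laterE[OF E1(1)[OF e] that(1)] that(2) by blast
    show "g (later (e, 0)) \<le> q (later (e, 0))"
      using E1(3)[OF e] by (simp add: later0)
    show "\<exists>u v. 0 \<le> v \<and> v \<le> u \<and> q (later (e, v)) < (1 + u) * g (later (e, v))"
    proof (intro exI conjI)
      \<comment> \<open>at the end of the path \<open>q\<close> vanishes and \<open>g\<close> does not\<close>
      let ?u = "T (fst e) - snd e"
      show u: "0 \<le> ?u" using q_pos(2)[OF E1(2)[OF e]] by simp
      have l: "later (e, ?u) \<in> topspace E" by (rule laterE[OF E1(1)[OF e] u])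
      have "q (later (e, ?u)) \<le> 0"
        using q_pos(2)[of "later (e, ?u)"] by (fastforce simp: later_def)
      moreover from this qY[OF l] gY[OF l] g0[of "later (e, ?u)"] have "0 < g (later (e, ?u))"
        by linarith
      ultimately show "q (later (e, ?u)) < (1 + ?u) * g (later (e, ?u))"
        using u by (smt (verit) mult_pos_pos)
    qed simp
  qed (use g0 in auto)
  have \<sigma>0: "0 \<le> \<sigma> e" if "e \<in> topspace E1" for e
    using \<sigma> that by (auto simp: continuous_map_def)
  have \<sigma>q: "0 < q (later (e, v))" if "e \<in> topspace E1" "0 \<le> v" "v \<le> \<sigma> e" for e v
  proof (cases "g (later (e, v)) = 0")
    case True
    then show ?thesis using qY gY laterE[OF E1(1)[OF that(1)] that(2)] by blast
  next
    case False
    with g0 have "0 < g (later (e, v))" by (simp add: less_le)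
    then have "0 < (1 + \<sigma> e) * g (later (e, v))"
      using \<sigma>0[OF that(1)] by simp
    with \<sigma>_le[OF that] show ?thesis by linarith
  qed
  have \<sigma>Z: "f (later (e, \<sigma> e)) \<in> Z" if e: "e \<in> topspace E1" for e
  proof -
    obtain v where v: "0 \<le> v" "v \<le> \<sigma> e" "q (later (e, v)) = (1 + \<sigma> e) * g (later (e, v))"
      using \<sigma>_eq[OF e] by blast
    have l: "later (e, v) \<in> topspace E" by (rule laterE[OF E1(1)[OF e] v(1)])
    have "g (later (e, v)) \<noteq> 0" using \<sigma>q[OF e v(1,2)] v(3) by auto
    then have "f (later (e, v)) \<in> Z" using gY[OF l] f_in[OF l] by blast
    then show ?thesis
      using stay[of "fst e" "snd e + v" "snd e + \<sigma> e"] l v by (simp add: later_def inE)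
  qed
  have \<sigma>_zero: "\<sigma> e = 0" if e: "e \<in> topspace E1" and eq: "g e = q e" for e
  proof (rule ccontr)
    assume "\<sigma> e \<noteq> 0"
    with \<sigma>0[OF e] have "0 < \<sigma> e" by simp
    then have "g e < (1 + \<sigma> e) * g e" using E1(2)[OF e] eq by simp
    with \<sigma>_le[OF e order_refl \<sigma>0[OF e]] eq show False by (simp add: later0)
  qed
  define E2 where "E2 = subtopology E {e. 0 < q e}"
  define \<gamma> where "\<gamma> = (\<lambda>e. r (f e, 1))"
  have \<gamma>: "continuous_map E2 (subtopology ?X Y) \<gamma>"
  proof -
    have fN: "continuous_map E2 (subtopology ?X N) f"
      unfolding continuous_map_in_subtopology E2_def
      using q_pos(1) U(3) by (auto intro: continuous_map_from_subtopology fEX)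
    have "continuous_map E2 unit_interval (\<lambda>e. 1)" by simp
    from continuous_map_compose_Pair[OF r fN this]
    have "continuous_map E2 ?X \<gamma>"
      unfolding \<gamma>_def by (rule continuous_map_into_fulltopology)
    then show ?thesis
      unfolding continuous_map_in_subtopology E2_def \<gamma>_def using q_pos(1) U(3) r1 by auto
  qed
  \<comment> \<open>the homotopy to be lifted: time runs backwards from \<open>t + \<sigma>\<close> to \<open>t\<close> and then stops\<close>
  define rewind where "rewind = (\<lambda>x. later (fst x, max 0 (\<sigma> (fst x) - snd x)))"
  have rewind: "continuous_map (prod_topology E1 half_line) E2 rewind"
  proof -
    have "continuous_map (prod_topology E1 half_line) half_line (\<lambda>x. max 0 (\<sigma> (fst x) - snd x))"
    proof (rule continuous_map_into_half_line)
      show "continuous_map (prod_topology E1 half_line) euclideanreal (\<lambda>x. max 0 (\<sigma> (fst x) - snd x))"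
        by (intro continuous_intros continuous_map_from_half_line[OF continuous_map_snd]
            continuous_map_from_half_line[OF continuous_map_compose'[OF \<sigma> continuous_map_fst]]) auto
    qed simp
    then have "continuous_map (prod_topology E1 half_line) E rewind"
      unfolding rewind_def by (rule later[OF continuous_map_compose'[OF idE1 continuous_map_fst]])
    moreover have "0 < q (rewind x)" if "x \<in> topspace (prod_topology E1 half_line)" for x
      unfolding rewind_def by (rule \<sigma>q) (use that \<sigma>0[of "fst x"] in auto)
    ultimately show ?thesis
      unfolding E2_def continuous_map_in_subtopology by auto
  qed
  define c where "c = (\<lambda>x. (1::real, \<lambda>v\<in>{0..}. r (x, 1 - min v 1)))"
  have c: "continuous_map (subtopology ?X (N - Y)) (hol (subtopology ?X (Z \<union> Y)) Y) c"
    unfolding c_def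
    by (rule continuous_map_track_in_holink[OF YZ N _ r r1 rZ]) (use N YZM in auto)
  have "continuous_map E1 ?X (\<lambda>e. f (later (e, \<sigma> e)))"
    by (rule continuous_map_compose'[OF fEX later[OF idE1 \<sigma>]])
  then have "continuous_map E1 (subtopology ?X (N - Y)) (\<lambda>e. f (later (e, \<sigma> e)))"
    unfolding continuous_map_in_subtopology
    using \<sigma>Z q_pos(1)[OF \<sigma>q[OF _ \<sigma>0 order_refl]] U(3) YZ by blast
  then have c\<sigma>: "continuous_map E1 (hol (subtopology ?X (Z \<union> Y)) Y) (\<lambda>e. c (f (later (e, \<sigma> e))))"
    by (rule continuous_map_compose'[OF c])
  obtain L where L: "continuous_map E1 (hol (subtopology ?X (Z \<union> Y)) Y) L"
    and L_start': "\<And>e. e \<in> topspace E1 \<Longrightarrow> path_start (L e) = \<gamma> (rewind (e, \<sigma> e))"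
    and L_zero: "\<And>e. \<lbrakk>e \<in> topspace E1; \<sigma> e = 0\<rbrakk> \<Longrightarrow> L e = c (f (later (e, \<sigma> e)))"
  proof (rule fibration_lifting_upto[OF fib c\<sigma> \<sigma> continuous_map_compose'[OF \<gamma> rewind]])
    show "\<gamma> (rewind (e, 0)) = path_start (c (f (later (e, \<sigma> e))))" if "e \<in> topspace E1" for e
      using \<sigma>0[OF that] by (simp add: \<gamma>_def rewind_def c_def)
  qed blast
  have L_start: "path_start (L e) = \<gamma> e" if "e \<in> topspace E1" for e
    using L_start'[OF that] by (simp add: rewind_def later0)
  have \<kappa>E1: "continuous_map E1 euclideanreal (\<lambda>e. \<kappa> e / 2)"
    using continuous_map_from_subtopology[OF continuous_map_from_subtopology[OF \<kappa>]]
    unfolding E1_def E_def by (intro continuous_intros) auto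
  obtain \<Phi> where \<Phi>: "continuous_map E1 (subtopology ?X Z) \<Phi>"
    and \<Phi>_near: "\<And>e. e \<in> topspace E1 \<Longrightarrow> mdist M (\<Phi> e) (path_start (L e)) \<le> \<kappa> e / 2"
    and \<Phi>_end: "\<And>e. \<lbrakk>e \<in> topspace E1; \<And>t. \<lbrakk>0 \<le> t; t \<le> fst (L e)\<rbrakk> \<Longrightarrow>
        2 * mdist M (snd (L e) t) (path_start (L e)) \<le> \<kappa> e / 2\<rbrakk> \<Longrightarrow> \<Phi> e = path_end (L e)"
    using continuous_map_initial_segment_of_holink[OF YZ L \<kappa>E1] E1(1) inE
    by (metis half_gt_zero)
  \<comment> \<open>On \<open>g = q\<close> the look-ahead time is \<open>0\<close>, so nothing was lifted, and the track is short enough to be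
    followed up to its end \<open>f e\<close>.\<close>
  have \<Phi>_edge: "\<Phi> e = f e" if e: "e \<in> topspace E1" and eq: "g e = q e" for e
  proof -
    have Le: "L e = c (f e)"
      using L_zero[OF e] \<sigma>_zero[OF e eq] by (simp add: later0)
    have N: "f e \<in> N" using q_pos(1)[OF E1(2)[OF e]] U(3) by blast
    have "\<Phi> e = path_end (L e)"
    proof (rule \<Phi>_end[OF e])
      fix t assume "0 \<le> t" "t \<le> fst (L e)"
      then have "mdist M (snd (L e) t) (path_start (L e)) \<le> \<theta> (f e)"
        using \<theta>_le[OF N, of "1 - t"] by (simp add: Le c_def)
      then show "2 * mdist M (snd (L e) t) (path_start (L e)) \<le> \<kappa> e / 2"
        using q_pos(3)[OF E1(2)[OF e]] by linarith
    qed
    then show ?thesis using r0[OF N] by (simp add: Le c_def)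
  qed
  define f' where "f' = (\<lambda>e. if 0 < \<kappa> e \<and> g e \<le> q e then \<Phi> e else f e)"
  have \<Phi>M: "\<Phi> e \<in> Z" if "e \<in> topspace E1" for e
    using \<Phi> that by (auto simp: continuous_map_in_subtopology)
  have inE1: "e \<in> topspace E1" if "e \<in> topspace E" "g e \<le> q e" for e
    using that by (simp add: E1_def)
  have f'Z: "f' e \<in> Z" if e: "e \<in> topspace E" for e
  proof (cases "g e \<le> q e")
    case True
    then show ?thesis using \<Phi>M inE1 e inE by (simp add: f'_def)
  next
    case False
    then have "f e \<notin> Y" using gY[OF e] q0[of e] by auto
    then show ?thesis using False f_in[OF e] by (simp add: f'_def)
  qed
  have near: "mdist M (f' e) (f e) \<le> \<kappa> e" if e: "fst e \<in> topspace \<Omega>" "0 \<le> snd e" for e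
  proof (cases "0 < \<kappa> e \<and> g e \<le> q e")
    case True
    then have e1: "e \<in> topspace E1" using e inE inE1 by simp
    have N: "f e \<in> N" using q_pos(1)[OF E1(2)[OF e1]] U(3) by blast
    have fM: "f e \<in> mspace M" "\<gamma> e \<in> mspace M" "\<Phi> e \<in> mspace M"
      using N assms(2) \<open>N \<subseteq> Y \<union> Z\<close> r1[OF N] \<Phi>M[OF e1] by (auto simp: \<gamma>_def)
    have "mdist M (\<gamma> e) (f e) \<le> \<theta> (f e)"
      using \<theta>_le[OF N, of 0] r0[OF N] by (simp add: \<gamma>_def mdist_commute)
    then have "mdist M (\<gamma> e) (f e) \<le> \<kappa> e / 4"
      using q_pos(3)[OF E1(2)[OF e1]] by linarith
    moreover have "mdist M (\<Phi> e) (\<gamma> e) \<le> \<kappa> e / 2"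
      using \<Phi>_near[OF e1] L_start[OF e1] by simp
    ultimately have "mdist M (\<Phi> e) (f e) \<le> \<kappa> e"
      using mdist_triangle[OF fM(3,2,1)] True by linarith
    then show ?thesis using True by (simp add: f'_def)
  next
    case False
    have "f e \<in> mspace M" using f e by (cases e) (auto simp: continuous_map_def Pi_iff)
    then have "mdist M (f e) (f e) = 0" by simp
    moreover have "f' e = f e" unfolding f'_def using False by (rule if_not_P)
    ultimately show ?thesis using \<kappa>0[OF e] by simp
  qed
  have f'M: "f' e \<in> mspace M" if "e \<in> topspace ?P" for e
  proof (cases "0 < \<kappa> e")
    case True
    then have "f' e \<in> Z" using that by (intro f'Z) (auto simp: inE)
    then show ?thesis using YZM by blast
  next
    case False
    then show ?thesis using f that by (auto simp: f'_def continuous_map_def Pi_iff)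
  qed
  have "continuous_map E ?X (\<lambda>e. if g e \<le> q e then \<Phi> e else f e)"
  proof (rule continuous_map_cases_le[OF g q])
    have "subtopology E {e \<in> topspace E. g e \<le> q e} = E1"
      unfolding E1_def by (metis Collect_conj_eq Collect_mem_eq subtopology_restrict)
    then show "continuous_map (subtopology E {e \<in> topspace E. g e \<le> q e}) ?X \<Phi>"
      using \<Phi> continuous_map_into_fulltopology by metis
    show "continuous_map (subtopology E {e \<in> topspace E. q e \<le> g e}) ?X f"
      by (rule continuous_map_from_subtopology[OF fEX])
    show "\<Phi> e = f e" if "e \<in> topspace E" "g e = q e" for e
      using \<Phi>_edge inE1 that by simp
  qed
  then have "continuous_map E ?X f'"
    by (rule continuous_map_eq) (auto simp: f'_def inE)
  then have f': "continuous_map ?P ?X f'"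
    unfolding E_def by (intro continuous_map_controlled_modification[OF f \<kappa> f'M] near) auto
  show thesis
  proof (rule that[OF f'])
    fix \<omega> t assume \<omega>: "\<omega> \<in> topspace \<Omega>" "0 \<le> (t::real)"
    show "mdist M (f' (\<omega>, t)) (f (\<omega>, t)) \<le> \<kappa> (\<omega>, t)" using near[of "(\<omega>, t)"] \<omega> by simp
    show "f' (\<omega>, t) \<in> Z" if "0 < \<kappa> (\<omega>, t)" using f'Z[of "(\<omega>, t)"] \<omega> that inE by simp
    show "f' (\<omega>, t) = f (\<omega>, t)" if "T \<omega> \<le> t"
    proof (rule ccontr)
      assume "f' (\<omega>, t) \<noteq> f (\<omega>, t)"
      then have "0 < \<kappa> (\<omega>, t)" "g (\<omega>, t) \<le> q (\<omega>, t)" by (auto simp: f'_def split: if_splits)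
      then have "(\<omega>, t) \<in> topspace E1" using \<omega> inE inE1 by simp
      then show False using q_pos(2)[OF E1(2)] that by fastforce
    qed
  qed
qed

section \<open>Removing all strata below the top one\<close>

lemma filt_diff_subset: "filt_diff S F i \<subseteq> F i"
  by (auto simp: filt_diff_def)

lemma filtered_spaceD:
  assumes "filtered_space X S F"
  shows "finite S"
    and "\<And>i. i \<in> S \<Longrightarrow> closedin X (F i)"
    and "topspace X = (\<Union>i\<in>S. F i)"
    and "\<And>i j. \<lbrakk>i \<in> S; j \<in> S; i \<noteq> j\<rbrakk> \<Longrightarrow> filt_diff S F i \<inter> filt_diff S F j = {}"
  using assms unfolding filtered_space_def by meson+

lemma filt_diff_subset_topspace:
  assumes "filtered_space X S F" "i \<in> S"
  shows "filt_diff S F i \<subseteq> topspace X"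
  using filtered_spaceD(3)[OF assms(1)] filt_diff_subset[of S F i] assms(2) by auto

lemma filt_diff_unique:
  assumes "filtered_space X S F" "i \<in> S" "j \<in> S" "x \<in> filt_diff S F i" "x \<in> filt_diff S F j"
  shows "i = j"
  using filtered_spaceD(4)[OF assms(1-3)] assms(4,5) by auto

text \<open>Among the finitely many indices \<open>k \<le> i\<close> with \<open>x \<in> F k\<close> take a minimal one.\<close>

lemma filtration_decomposes:
  assumes X: "filtered_space X S F" and i: "i \<in> S" and x: "x \<in> F i"
  obtains k where "k \<in> S" "k \<le> i" "x \<in> filt_diff S F k"
proof -
  let ?K = "{k \<in> S. k \<le> i \<and> x \<in> F k}"
  have "finite ?K" "?K \<noteq> {}"
    using filtered_spaceD(1)[OF X] i x by auto
  from finite_has_minimal[OF this] obtain k where k: "k \<in> ?K" "\<And>l. l \<in> ?K \<Longrightarrow> l \<le> k \<Longrightarrow> k = l"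
    by blast
  have "x \<notin> F l" if "l \<in> S" "l < k" for l
  proof
    assume "x \<in> F l"
    then have "l \<in> ?K" using that k(1) by (auto dest: less_imp_le intro: order_trans)
    from k(2)[OF this] that(2) show False by (metis order.strict_iff_order)
  qed
  then have "x \<in> filt_diff S F k"
    using k(1) by (auto simp: filt_diff_def)
  with k that show thesis by blast
qed

lemma index_below_if_in_filtration:
  assumes X: "filtered_space X S F" and "i \<in> S" "j \<in> S" "x \<in> F i" "x \<in> filt_diff S F j"
  shows "j \<le> i"
proof -
  obtain k where "k \<in> S" "k \<le> i" "x \<in> filt_diff S F k"
    using filtration_decomposes[OF X assms(2,4)] .
  with filt_diff_unique[OF X _ assms(3) _ assms(5)] show ?thesis by blast
qed

lemma point_lies_in_path_component:
  assumes "x \<in> topspace X"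
  obtains Z where "Z \<in> path_components_of X" "x \<in> Z"
proof -
  have "x \<in> \<Union>(path_components_of X)"
    using assms by (simp add: Union_path_components_of)
  then show thesis using that by blast
qed

text \<open>Only times \<open>t > 0\<close> are restricted, because the paths are to be pushed out of the stratum of
  their start point while the start point stays fixed.\<close>

definition order_preserving_family ::
    "'a metric \<Rightarrow> ('i::order \<Rightarrow> 'a set) \<Rightarrow> 'i set \<Rightarrow> 'i \<Rightarrow> 'z topology \<Rightarrow> ('z \<Rightarrow> real) \<Rightarrow>
      ('z \<times> real \<Rightarrow> 'a) \<Rightarrow> bool"
  where "order_preserving_family M D P i \<Omega> T f \<longleftrightarrow>
    continuous_map (prod_topology \<Omega> half_line) (mtopology_of M) f \<and>
    (\<forall>\<omega>\<in>topspace \<Omega>. \<forall>t>0. f (\<omega>, t) \<in> (\<Union>p\<in>P. D p) \<and> (T \<omega> \<le> t \<longrightarrow> f (\<omega>, t) \<in> D i) \<and>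
      (\<forall>u\<ge>t. \<forall>p\<in>P. \<forall>q\<in>P. f (\<omega>, t) \<in> D p \<and> f (\<omega>, u) \<in> D q \<longrightarrow> p \<le> q))"

text \<open>Apart from the top index \<open>i\<close>, the index \<open>k\<close> is maximal. Hence a path of the family first runs through
  strata of other indices below \<open>i\<close>, whose union is relatively closed, and from then on it is in \<open>X\<^sub>k\<close>
  and then in \<open>X\<^sub>i\<close>. This second part is pushed off \<open>X\<^sub>k\<close>, with a bound \<open>\<kappa>\<close> that vanishes on the first part
  and at time \<open>0\<close>.\<close>

lemma remove_stratum:
  fixes M :: "'a metric" and S :: "'i::order set" and \<Omega> :: "'z topology"
  assumes hs: "homotopically_stratified M S F"
    and P: "P \<subseteq> S" "i \<in> P" "\<And>p. p \<in> P \<Longrightarrow> p \<le> i"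
    and k: "k \<in> P" "k \<noteq> i" "\<And>p. \<lbrakk>p \<in> P; p \<noteq> i; k \<le> p\<rbrakk> \<Longrightarrow> p = k"
    and T: "continuous_map \<Omega> euclideanreal T"
    and s: "continuous_map \<Omega> euclideanreal s" "\<And>\<omega>. \<omega> \<in> topspace \<Omega> \<Longrightarrow> 0 < s \<omega>"
    and f: "order_preserving_family M (filt_diff S F) P i \<Omega> T f"
  obtains f' where "order_preserving_family M (filt_diff S F) (P - {k}) i \<Omega> T f'"
    "\<And>\<omega> t. \<lbrakk>\<omega> \<in> topspace \<Omega>; 0 \<le> t\<rbrakk> \<Longrightarrow> mdist M (f' (\<omega>, t)) (f (\<omega>, t)) \<le> s \<omega> * t"
    "\<And>\<omega> t. \<lbrakk>\<omega> \<in> topspace \<Omega>; 0 \<le> t; T \<omega> \<le> t\<rbrakk> \<Longrightarrow> f' (\<omega>, t) = f (\<omega>, t)"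
proof -
  let ?X = "mtopology_of M" and ?D = "filt_diff S F"
  let ?Q = "P - {k, i}"
  have X: "filtered_space ?X S F"
    using hs unfolding homotopically_stratified_def Let_def by (rule conjunct1)
  have iS: "i \<in> S" and kS: "k \<in> S" using P k by auto
  have ki: "k < i" using P(3)[OF k(1)] k(2) by (rule le_neq_trans)
  have DM: "?D p \<subseteq> mspace M" if "p \<in> S" for p
    using filt_diff_subset_topspace[OF X that] by simp
  have uniq: "p = q" if "x \<in> ?D p" "x \<in> ?D q" "p \<in> S" "q \<in> S" for x p q
    using filt_diff_unique[OF X] that by blast
  have tame: "tame ?X S F (?D k) (?D k \<union> ?D i)"
    and fib: "fibration (hol (subtopology ?X (?D i \<union> ?D k)) (?D k)) (subtopology ?X (?D k)) path_start"
    using hs[unfolded homotopically_stratified_def Let_def, THEN conjunct2, rule_format, OF iS kS ki]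
    by (rule conjunct1, rule conjunct2)
  from tame obtain N U r where U: "openin (subtopology ?X (?D k \<union> ?D i)) U" "?D k \<subseteq> U" "U \<subseteq> N"
    and N: "N \<subseteq> ?D k \<union> ?D i"
    and r: "continuous_map (prod_topology (subtopology ?X N) unit_interval) (subtopology ?X N) r"
    and r0: "\<forall>x\<in>N. r (x, 0) = x" and r1: "\<forall>x\<in>N. r (x, 1) \<in> ?D k"
    and rY: "\<forall>y\<in>?D k. \<forall>t\<in>{0..1}. r (y, t) = y"
    and rS: "\<forall>x\<in>N - ?D k. \<forall>Z\<in>strata ?X S F. x \<in> Z \<longrightarrow> (\<forall>t\<in>{0..<1}. r (x, t) \<in> Z)"
    unfolding tame_def by (elim exE conjE) (rule that)
  have rZ: "r (x, t) \<in> ?D i" if x: "x \<in> N - ?D k" and t: "0 \<le> t" "t < 1" for x t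
  proof -
    have "x \<in> topspace (subtopology ?X (?D i))" using x N DM[OF iS] by auto
    then obtain Z where Z: "Z \<in> path_components_of (subtopology ?X (?D i))" "x \<in> Z"
      using point_lies_in_path_component by metis
    then have "Z \<in> strata ?X S F" using iS by (auto simp: strata_def)
    then have "r (x, t) \<in> Z" using rS x Z(2) t by auto
    then show ?thesis using path_components_of_subset[OF Z(1)] by auto
  qed
  define C where "C = (\<Union>p\<in>?Q. F p)"
  have "finite ?Q"
    using filtered_spaceD(1)[OF X] P(1) by (auto intro: finite_subset)
  then have C: "closedin ?X C"
    unfolding C_def using filtered_spaceD(2)[OF X] P(1) by (intro closedin_Union) auto
  obtain \<delta> where \<delta>: "continuous_map ?X euclideanreal \<delta>" "\<And>x. 0 \<le> \<delta> x"
      "\<And>x. x \<in> mspace M \<Longrightarrow> \<delta> x = 0 \<longleftrightarrow> x \<in> C"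
    using closed_set_is_zero_set[OF C] by blast
  have inC: "x \<in> C \<longleftrightarrow> p \<in> ?Q" if x: "x \<in> ?D p" and p: "p \<in> P" for x p
  proof
    assume "p \<in> ?Q"
    then show "x \<in> C" using x filt_diff_subset[of S F p] by (auto simp: C_def)
  next
    assume "x \<in> C"
    then obtain q where q: "q \<in> ?Q" "x \<in> F q" by (auto simp: C_def)
    then have le: "p \<le> q" using index_below_if_in_filtration[OF X _ _ q(2) x] p P(1) by blast
    have "p \<noteq> k" using le k(3)[of q] q by auto
    moreover have "p \<noteq> i" using le P(3)[of q] q by auto
    ultimately show "p \<in> ?Q" using p by simp
  qed
  have fc: "continuous_map (prod_topology \<Omega> half_line) ?X f"
    and fP: "\<And>\<omega> t. \<lbrakk>\<omega> \<in> topspace \<Omega>; 0 < t\<rbrakk> \<Longrightarrow> \<exists>p\<in>P. f (\<omega>, t) \<in> ?D p"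
    and fend: "\<And>\<omega> t. \<lbrakk>\<omega> \<in> topspace \<Omega>; 0 < t; T \<omega> \<le> t\<rbrakk> \<Longrightarrow> f (\<omega>, t) \<in> ?D i"
    and fle: "\<And>\<omega> t u p q. \<lbrakk>\<omega> \<in> topspace \<Omega>; 0 < t; t \<le> u; p \<in> P; q \<in> P;
        f (\<omega>, t) \<in> ?D p; f (\<omega>, u) \<in> ?D q\<rbrakk> \<Longrightarrow> p \<le> q"
    using f unfolding order_preserving_family_def by blast+
  have fM: "f (\<omega>, t) \<in> mspace M" if "\<omega> \<in> topspace \<Omega>" "0 \<le> t" for \<omega> t
    using fc that by (auto simp: continuous_map_def Pi_iff)
  define \<kappa> where "\<kappa> = (\<lambda>e. s (fst e) * min (snd e) (\<delta> (f e)))"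
  have \<kappa>: "continuous_map (prod_topology \<Omega> half_line) euclideanreal \<kappa>"
    unfolding \<kappa>_def
    by (intro continuous_map_real_mult continuous_map_real_min continuous_map_compose'[OF s(1) continuous_map_fst]
        continuous_map_from_half_line[OF continuous_map_snd] continuous_map_compose'[OF \<delta>(1) fc])
  have \<kappa>0: "0 \<le> \<kappa> (\<omega>, t)" if "\<omega> \<in> topspace \<Omega>" "0 \<le> t" for \<omega> t
    using s(2)[OF that(1)] that(2) \<delta>(2) by (simp add: \<kappa>_def)
  have \<kappa>_pos: "0 < \<kappa> (\<omega>, t) \<longleftrightarrow> 0 < t \<and> f (\<omega>, t) \<notin> C" if "\<omega> \<in> topspace \<Omega>" "0 \<le> t" for \<omega> t
  proof -
    have "0 < \<delta> (f (\<omega>, t)) \<longleftrightarrow> f (\<omega>, t) \<notin> C"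
      using \<delta>(2)[of "f (\<omega>, t)"] \<delta>(3)[OF fM[OF that]] by (simp add: less_le)
    moreover have "0 < \<kappa> (\<omega>, t) \<longleftrightarrow> 0 < min t (\<delta> (f (\<omega>, t)))"
      using mult_less_cancel_left_pos[OF s(2)[OF that(1)], of 0 "min t (\<delta> (f (\<omega>, t)))"]
      by (simp only: \<kappa>_def fst_conv snd_conv mult_zero_right)
    ultimately show ?thesis by simp
  qed
  have ki_cases: "f (\<omega>, t) \<in> ?D k \<or> f (\<omega>, t) \<in> ?D i"
    if "\<omega> \<in> topspace \<Omega>" "0 \<le> t" "0 < \<kappa> (\<omega>, t)" for \<omega> t
  proof -
    have t: "0 < t" "f (\<omega>, t) \<notin> C" using \<kappa>_pos[OF that(1,2)] that(3) by auto
    with fP[OF that(1)] inC show ?thesis by fast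
  qed
  have stay: "f (\<omega>, u) \<in> ?D i"
    if \<omega>: "\<omega> \<in> topspace \<Omega>" and t: "0 < t" "t \<le> u" and ft: "f (\<omega>, t) \<in> ?D i" for \<omega> t u
  proof -
    obtain q where q: "q \<in> P" "f (\<omega>, u) \<in> ?D q" using fP[OF \<omega>, of u] t by auto
    have "i = q"
      using fle[OF \<omega> t P(2) q(1) ft q(2)] P(3)[OF q(1)] by (rule order.antisym)
    with q(2) show ?thesis by simp
  qed
  have persists: "0 < \<kappa> (\<omega>, u)" if \<omega>: "\<omega> \<in> topspace \<Omega>" and t: "0 \<le> t" "t \<le> u" "0 < \<kappa> (\<omega>, t)" for \<omega> t u
  proof -
    have t0: "0 < t" using \<kappa>_pos[OF \<omega> t(1)] t(3) by blast
    obtain q where q: "q \<in> P" "f (\<omega>, u) \<in> ?D q" using fP[OF \<omega>, of u] t0 t(2) by auto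
    have "k \<le> q"
      using ki_cases[OF \<omega> t(1,3)]
    proof
      assume "f (\<omega>, t) \<in> ?D k"
      with fle[OF \<omega> t0 t(2) k(1) q(1) _ q(2)] show ?thesis by blast
    next
      assume "f (\<omega>, t) \<in> ?D i"
      from fle[OF \<omega> t0 t(2) P(2) q(1) this q(2)] ki show ?thesis
        using less_imp_le order_trans by blast
    qed
    then have "q \<notin> ?Q" using k(3)[of q] by blast
    then have "f (\<omega>, u) \<notin> C" using inC[OF q(2,1)] by blast
    then show ?thesis using \<kappa>_pos[OF \<omega>, of u] t0 t(2) by simp
  qed
  obtain f' where f': "continuous_map (prod_topology \<Omega> half_line) ?X f'"
    and near: "\<And>\<omega> t. \<lbrakk>\<omega> \<in> topspace \<Omega>; 0 \<le> t\<rbrakk> \<Longrightarrow> mdist M (f' (\<omega>, t)) (f (\<omega>, t)) \<le> \<kappa> (\<omega>, t)"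
    and f'Z: "\<And>\<omega> t. \<lbrakk>\<omega> \<in> topspace \<Omega>; 0 \<le> t; 0 < \<kappa> (\<omega>, t)\<rbrakk> \<Longrightarrow> f' (\<omega>, t) \<in> ?D i"
    and f'end: "\<And>\<omega> t. \<lbrakk>\<omega> \<in> topspace \<Omega>; 0 \<le> t; T \<omega> \<le> t\<rbrakk> \<Longrightarrow> f' (\<omega>, t) = f (\<omega>, t)"
  proof (rule push_off_stratum[of "?D k" "?D i" M "F k" U N r \<Omega> f T \<kappa>])
    show "?D k \<inter> ?D i = {}" using uniq[OF _ _ kS iS] ki by blast
    show "?D k \<union> ?D i \<subseteq> mspace M" using DM kS iS by blast
    show "closedin ?X (F k)" by (rule filtered_spaceD(2)[OF X kS])
    have "x \<notin> ?D i" if "x \<in> F k" for x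
      using index_below_if_in_filtration[OF X kS iS that] ki by auto
    then show "F k \<inter> (?D k \<union> ?D i) = ?D k" using filt_diff_subset[of S F k] by blast
    show "f (\<omega>, u) \<in> ?D i"
      if "\<omega> \<in> topspace \<Omega>" "0 \<le> t" "t \<le> u" "0 < \<kappa> (\<omega>, t)" "f (\<omega>, t) \<in> ?D i" for \<omega> t u
      using stay that \<kappa>_pos by blast
    show "f (\<omega>, t) \<in> ?D i"
      if "\<omega> \<in> topspace \<Omega>" "0 \<le> t" "T \<omega> \<le> t" "0 < \<kappa> (\<omega>, t)" for \<omega> t
      using fend that \<kappa>_pos by blast
  qed (use U N r r0 r1 rY rZ fib fc T \<kappa> \<kappa>0 persists ki_cases in auto)
  have f'_eq: "f' (\<omega>, t) = f (\<omega>, t)" if "\<omega> \<in> topspace \<Omega>" "0 \<le> t" "\<not> 0 < \<kappa> (\<omega>, t)" for \<omega> t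
  proof -
    have "f' (\<omega>, t) \<in> mspace M" using f' that by (auto simp: continuous_map_def Pi_iff)
    moreover have "mdist M (f' (\<omega>, t)) (f (\<omega>, t)) = 0"
      using near[OF that(1,2)] that(3) mdist_nonneg[of M "f' (\<omega>, t)" "f (\<omega>, t)"] by linarith
    ultimately show ?thesis using fM[OF that(1,2)] by simp
  qed
  have low: "\<exists>p\<in>?Q. f (\<omega>, t) \<in> ?D p" if "\<omega> \<in> topspace \<Omega>" "0 < t" "\<not> 0 < \<kappa> (\<omega>, t)" for \<omega> t
    using fP[OF that(1,2)] \<kappa>_pos[OF that(1), of t] that inC by auto
  show thesis
  proof (rule that)
    show "order_preserving_family M ?D (P - {k}) i \<Omega> T f'"
      unfolding order_preserving_family_def
    proof (intro conjI ballI allI impI f')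
      fix \<omega> t assume \<omega>: "\<omega> \<in> topspace \<Omega>" and t: "0 < (t::real)"
      show "f' (\<omega>, t) \<in> (\<Union>p\<in>P - {k}. ?D p)"
      proof (cases "0 < \<kappa> (\<omega>, t)")
        case True
        then show ?thesis using f'Z[OF \<omega>, of t] t P(2) k(2) by auto
      next
        case False
        then show ?thesis using low[OF \<omega> t] f'_eq[OF \<omega>, of t] t by auto
      qed
      show "f' (\<omega>, t) \<in> ?D i" if "T \<omega> \<le> t"
        using fend[OF \<omega> t that] f'end[OF \<omega> _ that] t by simp
      fix u p q assume u: "t \<le> u" and p: "p \<in> P - {k}" and q: "q \<in> P - {k}"
        and *: "f' (\<omega>, t) \<in> ?D p \<and> f' (\<omega>, u) \<in> ?D q"
      have pS: "p \<in> S" "q \<in> S" using p q P(1) by auto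
      show "p \<le> q"
      proof (cases "0 < \<kappa> (\<omega>, u)")
        case True
        then have "q = i" using f'Z[OF \<omega>, of u] t u * uniq pS iS by auto
        then show ?thesis using P(3) p by blast
      next
        case False
        then have "\<not> 0 < \<kappa> (\<omega>, t)" using persists[OF \<omega> _ u] t by auto
        then have "f (\<omega>, t) \<in> ?D p" "f (\<omega>, u) \<in> ?D q"
          using * f'_eq[OF \<omega>] False t u by auto
        then show ?thesis using fle[OF \<omega> t u] p q by blast
      qed
    qed
    fix \<omega> t assume \<omega>: "\<omega> \<in> topspace \<Omega>" and t: "0 \<le> (t::real)"
    have "\<kappa> (\<omega>, t) \<le> s \<omega> * t"
      using s(2)[OF \<omega>] by (simp add: \<kappa>_def)
    with near[OF \<omega> t] show "mdist M (f' (\<omega>, t)) (f (\<omega>, t)) \<le> s \<omega> * t" by linarith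
    show "f' (\<omega>, t) = f (\<omega>, t)" if "T \<omega> \<le> t" by (rule f'end[OF \<omega> t that])
  qed
qed

text \<open>Remove the indices other than \<open>i\<close> one at a time, always a maximal one, and add up the bounds.\<close>

lemma push_into_top_stratum:
  fixes M :: "'a metric" and S :: "'i::order set" and \<Omega> :: "'z topology"
  assumes hs: "homotopically_stratified M S F"
    and T: "continuous_map \<Omega> euclideanreal T"
    and s: "continuous_map \<Omega> euclideanreal s" "\<And>\<omega>. \<omega> \<in> topspace \<Omega> \<Longrightarrow> 0 < s \<omega>"
    and P: "P \<subseteq> S" "i \<in> P" "\<And>p. p \<in> P \<Longrightarrow> p \<le> i"
    and f: "order_preserving_family M (filt_diff S F) P i \<Omega> T f"
  shows "\<exists>f' c. continuous_map (prod_topology \<Omega> half_line) (mtopology_of M) f' \<and>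
    (\<forall>\<omega>\<in>topspace \<Omega>. \<forall>t\<ge>0. mdist M (f' (\<omega>, t)) (f (\<omega>, t)) \<le> c * (s \<omega> * t) \<and>
      (T \<omega> \<le> t \<longrightarrow> f' (\<omega>, t) = f (\<omega>, t)) \<and> (0 < t \<longrightarrow> f' (\<omega>, t) \<in> filt_diff S F i))"
proof -
  have "filtered_space (mtopology_of M) S F"
    using hs unfolding homotopically_stratified_def Let_def by (rule conjunct1)
  then have "finite P"
    using P(1) filtered_spaceD(1) finite_subset by blast
  then show ?thesis
    using P f
  proof (induction "card P" arbitrary: P f rule: less_induct)
    case less
    show ?case
    proof (cases "P = {i}")
      case True
      have fc: "continuous_map (prod_topology \<Omega> half_line) (mtopology_of M) f"
        using less.prems by (simp add: order_preserving_family_def)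
      have "mdist M (f (\<omega>, t)) (f (\<omega>, t)) \<le> 0 * (s \<omega> * t)" if "\<omega> \<in> topspace \<Omega>" "0 \<le> t" for \<omega> t
      proof -
        have "f (\<omega>, t) \<in> mspace M" using fc that by (auto simp: continuous_map_def Pi_iff)
        then have "mdist M (f (\<omega>, t)) (f (\<omega>, t)) = 0" by simp
        then show ?thesis by simp
      qed
      moreover have "f (\<omega>, t) \<in> filt_diff S F i" if "\<omega> \<in> topspace \<Omega>" "0 < t" for \<omega> t
        using less.prems(5) that True by (auto simp: order_preserving_family_def)
      ultimately show ?thesis using fc by blast
    next
      case False
      then have "P - {i} \<noteq> {}" using less.prems(3) by blast
      from finite_has_maximal[OF _ this] less.prems(1) obtain k
        where k: "k \<in> P" "k \<noteq> i" "\<And>p. \<lbrakk>p \<in> P; p \<noteq> i; k \<le> p\<rbrakk> \<Longrightarrow> p = k"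
        by (metis Diff_iff finite_Diff insertCI insertE empty_iff)
      obtain f1 where f1: "order_preserving_family M (filt_diff S F) (P - {k}) i \<Omega> T f1"
        and near1: "\<And>\<omega> t. \<lbrakk>\<omega> \<in> topspace \<Omega>; 0 \<le> t\<rbrakk> \<Longrightarrow> mdist M (f1 (\<omega>, t)) (f (\<omega>, t)) \<le> s \<omega> * t"
        and end1: "\<And>\<omega> t. \<lbrakk>\<omega> \<in> topspace \<Omega>; 0 \<le> t; T \<omega> \<le> t\<rbrakk> \<Longrightarrow> f1 (\<omega>, t) = f (\<omega>, t)"
        using remove_stratum[OF hs less.prems(2-4) k T s less.prems(5)] by blast
      have card: "card (P - {k}) < card P"
        by (rule card_Diff1_less[OF less.prems(1) k(1)])
      have "finite (P - {k})" "P - {k} \<subseteq> S" "i \<in> P - {k}" "\<And>p. p \<in> P - {k} \<Longrightarrow> p \<le> i"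
        using less.prems k by auto
      from less.hyps[OF card this f1] obtain f' c
        where f': "continuous_map (prod_topology \<Omega> half_line) (mtopology_of M) f'"
          and f'2: "\<forall>\<omega>\<in>topspace \<Omega>. \<forall>t\<ge>0. mdist M (f' (\<omega>, t)) (f1 (\<omega>, t)) \<le> c * (s \<omega> * t) \<and>
            (T \<omega> \<le> t \<longrightarrow> f' (\<omega>, t) = f1 (\<omega>, t)) \<and> (0 < t \<longrightarrow> f' (\<omega>, t) \<in> filt_diff S F i)"
        by blast
      have M: "continuous_map (prod_topology \<Omega> half_line) (mtopology_of M) f"
        "continuous_map (prod_topology \<Omega> half_line) (mtopology_of M) f1"
        using less.prems(5) f1 by (auto simp: order_preserving_family_def)
      have "mdist M (f' (\<omega>, t)) (f (\<omega>, t)) \<le> (c + 1) * (s \<omega> * t)" if "\<omega> \<in> topspace \<Omega>" "0 \<le> t" for \<omega> t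
      proof -
        have "f (\<omega>, t) \<in> mspace M" "f1 (\<omega>, t) \<in> mspace M" "f' (\<omega>, t) \<in> mspace M"
          using M f' that by (auto simp: continuous_map_def Pi_iff)
        then have "mdist M (f' (\<omega>, t)) (f (\<omega>, t)) \<le> mdist M (f' (\<omega>, t)) (f1 (\<omega>, t)) + mdist M (f1 (\<omega>, t)) (f (\<omega>, t))"
          by (intro mdist_triangle)
        also have "\<dots> \<le> c * (s \<omega> * t) + s \<omega> * t"
          using f'2 near1 that by (intro add_mono) auto
        finally show ?thesis by (simp add: algebra_simps)
      qed
      moreover have "f' (\<omega>, t) = f (\<omega>, t)" if "\<omega> \<in> topspace \<Omega>" "0 \<le> t" "T \<omega> \<le> t" for \<omega> t
        using f'2 end1 that by simp
      ultimately show ?thesis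
        using f' f'2 by (intro exI[of _ f'] exI[of _ "c + 1"]) simp
    qed
  qed
qed

section \<open>Holinks and order preserving paths\<close>

lemma image_subset_path_component:
  assumes g: "continuous_map (top_of_set I) X g" and I: "path_connected I"
    and A: "g ` I \<subseteq> A" and C: "C \<in> path_components_of (subtopology X A)"
    and t: "t \<in> I" "g t \<in> C"
  shows "g ` I \<subseteq> C"
proof -
  have "path_connectedin (top_of_set I) I"
    using I by (simp add: path_connectedin_subtopology)
  then have "path_connectedin X (g ` I)"
    by (rule path_connectedin_continuous_map_image[OF g])
  then have "path_connectedin (subtopology X A) (g ` I)"
    using A by (simp add: path_connectedin_subtopology)
  then show ?thesis
    using C t by (intro path_components_of_maximal) (auto simp: disjnt_iff)
qed

lemma strata_index:
  assumes "Z \<in> strata X S F"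
  obtains i where "i \<in> S" "Z \<in> path_components_of (subtopology X (filt_diff S F i))"
    "Z \<subseteq> filt_diff S F i" "Z \<subseteq> topspace X"
proof -
  obtain i where i: "i \<in> S" "Z \<in> path_components_of (subtopology X (filt_diff S F i))"
    using assms by (auto simp: strata_def)
  from path_components_of_subset[OF i(2)] show thesis
    by (intro that[OF i]) auto
qed

lemma topspace_holink:
  "topspace (hol (subtopology X W) Y) = {\<omega> \<in> topspace (moore_path_space X).
     (\<forall>t\<ge>0. snd \<omega> t \<in> W) \<and> 0 < fst \<omega> \<and> path_start \<omega> \<in> Y \<and>
     (\<forall>t\<in>{0<..fst \<omega>}. snd \<omega> t \<in> topspace (subtopology X W) - Y)}"
  unfolding hol_def moore_path_space_subtopology topspace_subtopology by blast

lemma topspace_pop: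
  "topspace (pop X S F Xb (topspace X) Xa) = {\<omega> \<in> topspace (moore_path_space X).
     order_preserving_path S F \<omega> \<and> path_start \<omega> \<in> Xa \<and> path_end \<omega> \<in> Xb}"
  unfolding pop_def subtopology_topspace topspace_subtopology by blast

text \<open>The existence of the path forces \<open>j \<le> i\<close>: it lies in the closed set \<open>F i\<close> at all positive times, hence
  also at time \<open>0\<close>.\<close>

lemma holink_path_order_preserving:
  assumes X: "filtered_space X S F"
    and ij: "i \<in> S" "j \<in> S" "Xa \<subseteq> filt_diff S F j" "Xb \<subseteq> filt_diff S F i"
    and \<omega>: "\<omega> \<in> topspace (hol (subtopology X (Xb \<union> Xa)) Xa)"
  shows "order_preserving_path S F \<omega>" "path_end \<omega> \<in> Xb"
proof -
  have w: "\<omega> \<in> topspace (moore_path_space X)" "0 < fst \<omega>" "path_start \<omega> \<in> Xa"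
      "\<And>t. \<lbrakk>0 < t; t \<le> fst \<omega>\<rbrakk> \<Longrightarrow> snd \<omega> t \<in> Xb"
    using \<omega> unfolding topspace_holink by auto
  show "path_end \<omega> \<in> Xb" using w(2) w(4)[OF w(2)] by simp
  have cont: "continuous_map half_line X (snd \<omega>)"
    using w(1) unfolding topspace_moore_path_space mem_Collect_eq case_prod_beta by blast
  have "closedin half_line {t \<in> topspace half_line. snd \<omega> t \<in> F i}"
    by (rule closedin_continuous_map_preimage[OF cont filtered_spaceD(2)[OF X ij(1)]])
  then have "closed {t \<in> {0..}. snd \<omega> t \<in> F i}"
    by (simp add: closedin_closed_eq)
  moreover have "{0<..fst \<omega>} \<subseteq> {t \<in> {0..}. snd \<omega> t \<in> F i}"
  proof
    fix x assume x: "x \<in> {0<..fst \<omega>}"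
    then have "snd \<omega> x \<in> F i" using w(4)[of x] ij(4) filt_diff_subset[of S F i] by auto
    with x show "x \<in> {t \<in> {0..}. snd \<omega> t \<in> F i}" by simp
  qed
  ultimately have "closure {0<..fst \<omega>} \<subseteq> {t \<in> {0..}. snd \<omega> t \<in> F i}"
    by (rule closure_minimal[rotated])
  moreover have "0 \<in> closure {0<..fst \<omega>}" using w(2) by simp
  ultimately have "snd \<omega> 0 \<in> F i" by blast
  then have ji: "j \<le> i"
    using index_below_if_in_filtration[OF X ij(1,2)] w(3) ij(3) by auto
  have idx: "p = (if t = 0 then j else i)" if "0 \<le> t" "t \<le> fst \<omega>" "p \<in> S" "snd \<omega> t \<in> filt_diff S F p" for t p
  proof (cases "t = 0")
    case True
    with w(3) ij(3) have "snd \<omega> t \<in> filt_diff S F j" by auto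
    with filt_diff_unique[OF X that(3) ij(2) that(4)] True show ?thesis by simp
  next
    case False
    with w(4)[of t] ij(4) that have "snd \<omega> t \<in> filt_diff S F i" by auto
    with filt_diff_unique[OF X that(3) ij(1) that(4)] False show ?thesis by simp
  qed
  show "order_preserving_path S F \<omega>"
    unfolding order_preserving_path_def
  proof (intro allI ballI impI, elim conjE)
    fix t1 t2 p q assume *: "p \<in> S" "q \<in> S" "0 \<le> t1" "t1 \<le> t2" "t2 \<le> fst \<omega>"
      "snd \<omega> t1 \<in> filt_diff S F q" "snd \<omega> t2 \<in> filt_diff S F p"
    have "q = (if t1 = 0 then j else i)" by (rule idx) (use * in auto)
    moreover have "p = (if t2 = 0 then j else i)" by (rule idx) (use * in auto)
    ultimately show "q \<le> p" using ji *(3,4) by auto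
  qed
qed

lemma holink_subspace_of_pop:
  assumes X: "filtered_space X S F"
    and ij: "i \<in> S" "j \<in> S" "Xa \<subseteq> filt_diff S F j" "Xb \<subseteq> filt_diff S F i"
  defines "A \<equiv> hol (subtopology X (Xb \<union> Xa)) Xa"
  shows "topspace A \<subseteq> topspace (pop X S F Xb (topspace X) Xa)"
    and "A = subtopology (pop X S F Xb (topspace X) Xa) (topspace A)"
proof -
  show sub: "topspace A \<subseteq> topspace (pop X S F Xb (topspace X) Xa)"
  proof
    fix \<omega> assume "\<omega> \<in> topspace A"
    with holink_path_order_preserving[OF X ij, of \<omega>]
    show "\<omega> \<in> topspace (pop X S F Xb (topspace X) Xa)"
      unfolding topspace_pop A_def topspace_holink by blast
  qed
  obtain R1 where R1: "A = subtopology (moore_path_space X) R1"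
    unfolding A_def hol_def moore_path_space_subtopology subtopology_subtopology by blast
  obtain R2 where R2: "pop X S F Xb (topspace X) Xa = subtopology (moore_path_space X) R2"
    unfolding pop_def subtopology_topspace by blast
  have "subtopology (pop X S F Xb (topspace X) Xa) (topspace A)
      = subtopology (moore_path_space X) (R2 \<inter> topspace A)"
    unfolding R2 subtopology_subtopology ..
  also have "R2 \<inter> topspace A = topspace (moore_path_space X) \<inter> R1"
    using sub unfolding R1 R2 topspace_subtopology by blast
  also have "subtopology (moore_path_space X) (topspace (moore_path_space X) \<inter> R1) = A"
    unfolding R1 by (metis subtopology_restrict)
  finally show "A = subtopology (pop X S F Xb (topspace X) Xa) (topspace A)" ..
qed

text \<open>The path is constant after its end, so times beyond the end can be replaced by the end time.\<close>

lemma pop_path_indices: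
  fixes M :: "'a metric"
  assumes X: "filtered_space (mtopology_of M) S F"
    and ij: "i \<in> S" "j \<in> S" "Xa \<subseteq> filt_diff S F j" "Xb \<subseteq> filt_diff S F i"
    and \<omega>: "\<omega> \<in> topspace (pop (mtopology_of M) S F Xb (topspace (mtopology_of M)) Xa)"
  shows "0 \<le> t \<Longrightarrow> \<exists>p\<in>S. j \<le> p \<and> p \<le> i \<and> snd \<omega> t \<in> filt_diff S F p"
    and "\<lbrakk>0 \<le> t; t \<le> u; p \<in> S; q \<in> S; snd \<omega> t \<in> filt_diff S F p; snd \<omega> u \<in> filt_diff S F q\<rbrakk> \<Longrightarrow> p \<le> q"
proof -
  let ?X = "mtopology_of M"
  have w: "\<omega> \<in> topspace (moore_path_space ?X)" "order_preserving_path S F \<omega>"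
      "path_start \<omega> \<in> Xa" "path_end \<omega> \<in> Xb"
    using \<omega> unfolding topspace_pop by auto
  have T: "0 \<le> fst \<omega>" and cont: "continuous_map half_line ?X (snd \<omega>)"
    using w(1) unfolding topspace_moore_path_space mem_Collect_eq case_prod_beta by blast+
  have clip: "snd \<omega> t = snd \<omega> (min t (fst \<omega>))" for t
  proof (cases "t \<le> fst \<omega>")
    case False
    then show ?thesis
      using moore_path_constant_after_end[OF w(1), of t] by (simp add: min_def)
  qed simp
  have ord: "p \<le> q" if "0 \<le> t" "t \<le> u" "p \<in> S" "q \<in> S"
      "snd \<omega> t \<in> filt_diff S F p" "snd \<omega> u \<in> filt_diff S F q" for t u p q
  proof -
    have "0 \<le> min t (fst \<omega>)" "min t (fst \<omega>) \<le> min u (fst \<omega>)" "min u (fst \<omega>) \<le> fst \<omega>"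
      using that T by auto
    moreover have "snd \<omega> (min t (fst \<omega>)) \<in> filt_diff S F p" "snd \<omega> (min u (fst \<omega>)) \<in> filt_diff S F q"
      using that clip by metis+
    ultimately show ?thesis
      using w(2) that(3,4) unfolding order_preserving_path_def by blast
  qed
  then show "\<lbrakk>0 \<le> t; t \<le> u; p \<in> S; q \<in> S; snd \<omega> t \<in> filt_diff S F p; snd \<omega> u \<in> filt_diff S F q\<rbrakk> \<Longrightarrow> p \<le> q"
    by blast
  show "\<exists>p\<in>S. j \<le> p \<and> p \<le> i \<and> snd \<omega> t \<in> filt_diff S F p" if t: "0 \<le> t"
  proof -
    have "snd \<omega> t \<in> topspace ?X" using cont t by (auto simp: continuous_map_def)
    then obtain l where "l \<in> S" "snd \<omega> t \<in> F l" using filtered_spaceD(3)[OF X] by auto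
    then obtain p where p: "p \<in> S" "snd \<omega> t \<in> filt_diff S F p"
      using filtration_decomposes[OF X] by metis
    have "j \<le> p"
      by (rule ord[of 0 t]) (use t ij w(3) p in auto)
    moreover have "p \<le> i"
    proof (rule ord[of t "max t (fst \<omega>)"])
      have "snd \<omega> (max t (fst \<omega>)) = path_end \<omega>"
        by (rule moore_path_constant_after_end[OF w(1)]) simp
      then show "snd \<omega> (max t (fst \<omega>)) \<in> filt_diff S F i" using w(4) ij(4) by auto
    qed (use t ij p in auto)
    ultimately show ?thesis using p by blast
  qed
qed

theorem theorem4p9:
  fixes M :: "'a metric"
    and S :: "'i::order set"
    and F :: "'i \<Rightarrow> 'a set"
    and Xa Xb :: "'a set"
  assumes "homotopically_stratified M S F"
    and "Xa \<in> strata (mtopology_of M) S F"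
    and "Xb \<in> strata (mtopology_of M) S F"
    and "Xa \<noteq> Xb"
  shows "special_path_inclusion
    (hol (subtopology (mtopology_of M) (Xb \<union> Xa)) Xa)
    (pop (mtopology_of M) S F Xb (topspace (mtopology_of M)) Xa)"
proof -
  let ?X = "mtopology_of M" and ?D = "filt_diff S F"
  define A where "A = hol (subtopology ?X (Xb \<union> Xa)) Xa"
  define B where "B = pop ?X S F Xb (topspace ?X) Xa"
  have X: "filtered_space ?X S F"
    using assms(1) unfolding homotopically_stratified_def Let_def by (rule conjunct1)
  obtain j where j: "j \<in> S" "Xa \<in> path_components_of (subtopology ?X (?D j))" "Xa \<subseteq> ?D j" "Xa \<subseteq> topspace ?X"
    by (rule strata_index[OF assms(2)])
  obtain i where i: "i \<in> S" "Xb \<in> path_components_of (subtopology ?X (?D i))" "Xb \<subseteq> ?D i" "Xb \<subseteq> topspace ?X"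
    by (rule strata_index[OF assms(3)])
  have disj: "Xa \<inter> Xb = {}"
  proof (cases "i = j")
    case True
    then show ?thesis
      using path_components_of_disjoint[OF j(2), of Xb] i(2) assms(4) by (simp add: disjnt_def)
  next
    case False
    then show ?thesis using filtered_spaceD(4)[OF X i(1) j(1)] i(3) j(3) by blast
  qed
  have AB: "topspace A \<subseteq> topspace B" "A = subtopology B (topspace A)"
    unfolding A_def B_def by (rule holink_subspace_of_pop[OF X i(1) j(1,3) i(3)])+
  have "\<exists>h. continuous_map (prod_topology B unit_interval) B h \<and>
         (\<forall>\<omega>\<in>topspace B. h (\<omega>, 0) = \<omega>) \<and>
         (\<forall>\<omega>\<in>topspace B. \<forall>s\<in>{0..1}.
            path_start (h (\<omega>, s)) = path_start \<omega> \<and> path_end (h (\<omega>, s)) = path_end \<omega>) \<and>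
         (\<forall>\<omega>\<in>topspace B. \<forall>s\<in>{0<..1}. h (\<omega>, s) \<in> topspace A)"
  proof (cases "topspace B = {}")
    case True
    then show ?thesis
      by (intro exI[of _ fst]) (simp add: continuous_map_fst)
  next
    case False
    note path = pop_path_indices[OF X i(1) j(1,3) i(3), folded B_def]
    have wB: "\<omega> \<in> topspace (moore_path_space ?X)" "path_start \<omega> \<in> Xa" "path_end \<omega> \<in> Xb"
      if "\<omega> \<in> topspace B" for \<omega>
      using that unfolding B_def topspace_pop by auto
    have wT: "0 \<le> fst \<omega>" "snd \<omega> \<in> extensional {0..}" "continuous_map half_line ?X (snd \<omega>)"
      if "\<omega> \<in> topspace B" for \<omega>
      using wB(1)[OF that] unfolding topspace_moore_path_space mem_Collect_eq case_prod_beta by blast+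
    have wend: "snd \<omega> t = path_end \<omega>" if "\<omega> \<in> topspace B" "fst \<omega> \<le> t" for \<omega> t
      by (rule moore_path_constant_after_end[OF wB(1)[OF that(1)] that(2)])
    have Tpos: "0 < fst \<omega>" if "\<omega> \<in> topspace B" for \<omega>
      using wB(2,3)[OF that] wT(1)[OF that] disj by (cases "fst \<omega> = 0") auto
    define P where "P = {p \<in> S. j \<le> p \<and> p \<le> i}"
    have P: "P \<subseteq> S" "\<And>p. p \<in> P \<Longrightarrow> p \<le> i" by (auto simp: P_def)
    \<comment> \<open>any order preserving path from \<open>Xa\<close> to \<open>Xb\<close> shows \<open>j \<le> i\<close>\<close>
    obtain \<omega>0 where "\<omega>0 \<in> topspace B" using False by blast
    then have "i \<in> P"
      using path(1)[of \<omega>0 0] i(1) by (auto simp: P_def)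
    \<comment> \<open>The parameter \<open>s \<in> (0, 1]\<close> of the homotopy is part of the parameter space, and its value bounds the displacement.\<close>
    define \<Omega> where "\<Omega> = prod_topology B (top_of_set {0<..1::real})"
    have \<Omega>: "\<omega> \<in> topspace \<Omega> \<longleftrightarrow> fst \<omega> \<in> topspace B \<and> 0 < snd \<omega> \<and> snd \<omega> \<le> 1" for \<omega>
      by (cases \<omega>) (auto simp: \<Omega>_def)
    define f where "f = (\<lambda>x::('a moore_path \<times> real) \<times> real. snd (fst (fst x)) (snd x))"
    have Bm: "continuous_map B (moore_path_space ?X) (\<lambda>\<omega>. \<omega>)"
      unfolding B_def pop_def subtopology_topspace by (rule continuous_map_from_subtopology) simp
    have f: "continuous_map (prod_topology (prod_topology B Y) half_line) ?X f" for Y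
    proof -
      have "continuous_map (prod_topology (prod_topology B Y) half_line) (moore_path_space ?X) (\<lambda>x. fst (fst x))"
        by (rule continuous_map_compose'[OF Bm continuous_map_compose'[OF continuous_map_fst continuous_map_fst]])
      from continuous_map_compose_Pair[OF continuous_map_moore_eval this continuous_map_snd]
      show ?thesis by (simp add: f_def)
    qed
    have dur: "continuous_map (prod_topology B Y) half_line (\<lambda>\<omega>. fst (fst \<omega>))" for Y :: "real topology"
      by (rule continuous_map_compose'[OF continuous_map_compose'[OF continuous_map_moore_duration Bm] continuous_map_fst])
    have fam: "order_preserving_family M ?D P i \<Omega> (\<lambda>\<omega>. fst (fst \<omega>)) f"
      unfolding order_preserving_family_def
    proof (intro conjI ballI allI impI)
      show "continuous_map (prod_topology \<Omega> half_line) ?X f"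
        unfolding \<Omega>_def by (rule f)
      fix \<omega> t assume "\<omega> \<in> topspace \<Omega>" and t: "0 < (t::real)"
      then have \<omega>: "fst \<omega> \<in> topspace B" using \<Omega> by blast
      show "f (\<omega>, t) \<in> (\<Union>p\<in>P. ?D p)"
        using path(1)[OF \<omega>, of t] t by (auto simp: f_def P_def)
      show "f (\<omega>, t) \<in> ?D i" if "fst (fst \<omega>) \<le> t"
        using wend[OF \<omega> that] wB(3)[OF \<omega>] i(3) by (auto simp: f_def)
      show "p \<le> q" if "t \<le> u" "p \<in> P" "q \<in> P" "f (\<omega>, t) \<in> ?D p \<and> f (\<omega>, u) \<in> ?D q" for u p q
        using path(2)[OF \<omega>, of t u p q] that t by (auto simp: f_def P_def)
    qed
    have T\<Omega>: "continuous_map \<Omega> euclideanreal (\<lambda>\<omega>. fst (fst \<omega>))"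
      unfolding \<Omega>_def by (rule continuous_map_from_half_line[OF dur])
    have s\<Omega>: "continuous_map \<Omega> euclideanreal snd"
      unfolding \<Omega>_def by (rule continuous_map_into_fulltopology[OF continuous_map_snd])
    obtain f' c where f': "continuous_map (prod_topology \<Omega> half_line) ?X f'"
      and f'2: "\<forall>\<omega>\<in>topspace \<Omega>. \<forall>t\<ge>0. mdist M (f' (\<omega>, t)) (f (\<omega>, t)) \<le> c * (snd \<omega> * t) \<and>
        (fst (fst \<omega>) \<le> t \<longrightarrow> f' (\<omega>, t) = f (\<omega>, t)) \<and> (0 < t \<longrightarrow> f' (\<omega>, t) \<in> ?D i)"
      using push_into_top_stratum[OF assms(1) T\<Omega> s\<Omega> _ P(1) \<open>i \<in> P\<close> P(2) fam] \<Omega> by blast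
    \<comment> \<open>At \<open>s = 0\<close> the original path is inserted; the bound, which is proportional to \<open>s\<close> and to the time,
      makes the result continuous there and fixes the start points.\<close>
    define G where "G = (\<lambda>x. if 0 < snd (fst x) then f' x else f x)"
    let ?BI = "prod_topology B unit_interval"
    have fM: "f (\<omega>, t) \<in> mspace M" if "fst \<omega> \<in> topspace B" "0 \<le> t" for \<omega> t
      using wT(3)[OF that(1)] that(2) by (auto simp: f_def continuous_map_def)
    have f'M: "f' (\<omega>, t) \<in> mspace M" if "\<omega> \<in> topspace \<Omega>" "0 \<le> t" for \<omega> t
      using f' that by (auto simp: continuous_map_def Pi_iff)
    have G: "continuous_map (prod_topology ?BI half_line) ?X G"
    proof (rule continuous_map_controlled_modification[OF f])
      let ?\<kappa> = "\<lambda>x. c * (snd (fst x) * snd x)"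
      show "continuous_map (prod_topology ?BI half_line) euclideanreal ?\<kappa>"
      proof (rule continuous_map_real_mult_left, rule continuous_map_real_mult)
        show "continuous_map (prod_topology ?BI half_line) euclideanreal (\<lambda>x. snd (fst x))"
          by (rule continuous_map_compose'[OF continuous_map_into_fulltopology[OF continuous_map_snd] continuous_map_fst])
        show "continuous_map (prod_topology ?BI half_line) euclideanreal snd"
          by (rule continuous_map_from_half_line[OF continuous_map_snd])
      qed
      fix x assume x: "x \<in> topspace (prod_topology ?BI half_line)"
      obtain \<omega> t where xt: "x = (\<omega>, t)" by (cases x)
      with x have \<omega>: "fst \<omega> \<in> topspace B" "0 \<le> snd \<omega>" "snd \<omega> \<le> 1" "0 \<le> t" by auto
      show "G x \<in> mspace M"
        using fM[OF \<omega>(1,4)] f'M[of \<omega> t] \<omega> \<Omega> by (auto simp: G_def xt)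
      show "mdist M (G x) (f x) \<le> ?\<kappa> x"
      proof (cases "0 < snd \<omega>")
        case True
        then show ?thesis using f'2 \<omega> \<Omega> by (simp add: G_def xt)
      next
        case False
        have "mdist M (f x) (f x) = 0" using fM[OF \<omega>(1,4)] xt by simp
        then show ?thesis using False \<omega> by (simp add: G_def xt)
      qed
    next
      let ?\<kappa> = "\<lambda>x. c * (snd (fst x) * snd x)"
      let ?P = "prod_topology ?BI half_line"
      let ?E = "subtopology ?P {x. 0 < ?\<kappa> x}"
      have pos: "0 < snd (fst x)" if "x \<in> topspace ?E" for x
        using that by (cases "snd (fst x) = 0") (auto simp: less_le)
      have id: "continuous_map ?E ?P (\<lambda>x. x)"
        by (rule continuous_map_from_subtopology) simp
      have "continuous_map ?E (top_of_set {0<..1}) (\<lambda>x. snd (fst x))"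
        unfolding continuous_map_in_subtopology
      proof
        show "continuous_map ?E euclideanreal (\<lambda>x. snd (fst x))"
          by (rule continuous_map_into_fulltopology[OF continuous_map_compose'[OF continuous_map_snd
              continuous_map_compose'[OF continuous_map_fst id]]])
        show "(\<lambda>x. snd (fst x)) \<in> topspace ?E \<rightarrow> {0<..1}"
        proof
          fix x assume x: "x \<in> topspace ?E"
          then have "snd (fst x) \<le> 1" by (simp add: mem_Times_iff)
          with pos[OF x] show "snd (fst x) \<in> {0<..1}" by simp
        qed
      qed
      moreover have "continuous_map ?E B (\<lambda>x. fst (fst x))"
        by (rule continuous_map_compose'[OF continuous_map_fst continuous_map_compose'[OF continuous_map_fst id]])
      ultimately have "continuous_map ?E \<Omega> (\<lambda>x. (fst (fst x), snd (fst x)))"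
        unfolding \<Omega>_def by (intro continuous_map_pairedI)
      from continuous_map_compose_Pair[OF f' this continuous_map_compose'[OF continuous_map_snd id]]
      have "continuous_map ?E ?X f'" by simp
      then show "continuous_map ?E ?X G"
        by (rule continuous_map_eq) (simp add: G_def pos del: topspace_subtopology)
    qed
    have Gend: "G (\<omega>, t) = path_end (fst \<omega>)" if "\<omega> \<in> topspace ?BI" "fst (fst \<omega>) \<le> t" for \<omega> t
    proof -
      have \<omega>: "fst \<omega> \<in> topspace B" "snd \<omega> \<le> 1" using that(1) by auto
      then have "0 \<le> t" using wT(1) that(2) by (meson order_trans)
      then show ?thesis
        using f'2 \<Omega> \<omega> that(2) wend[OF \<omega>(1) that(2)] by (simp add: G_def f_def)
    qed
    have G0: "G (\<omega>, 0) = path_start (fst \<omega>)" if "\<omega> \<in> topspace ?BI" for \<omega>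
    proof (cases "0 < snd \<omega>")
      case True
      with that have \<omega>: "\<omega> \<in> topspace \<Omega>" "fst \<omega> \<in> topspace B" using \<Omega> by auto
      then have "mdist M (f' (\<omega>, 0)) (f (\<omega>, 0)) \<le> 0" using f'2 by fastforce
      then have "mdist M (f' (\<omega>, 0)) (f (\<omega>, 0)) = 0" by (simp add: antisym)
      then have "f' (\<omega>, 0) = f (\<omega>, 0)" using f'M[OF \<omega>(1), of 0] fM[OF \<omega>(2), of 0] by simp
      then show ?thesis using True by (simp add: G_def f_def)
    qed (simp add: G_def f_def)
    define h where "h = (\<lambda>\<omega>. (fst (fst \<omega>), \<lambda>t\<in>{0..}. G (\<omega>, t)))"
    have hm: "continuous_map ?BI (moore_path_space ?X) h"
      unfolding h_def
    proof (rule continuous_map_into_moore_path_space[OF dur G])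
      show "G (\<omega>, t) = G (\<omega>, fst (fst \<omega>))" if "\<omega> \<in> topspace ?BI" "fst (fst \<omega>) \<le> t" for \<omega> t
        using Gend[OF that] Gend[OF that(1) order_refl] by simp
    qed
    have h_start: "path_start (h \<omega>) = path_start (fst \<omega>)"
      and h_end: "path_end (h \<omega>) = path_end (fst \<omega>)" if "\<omega> \<in> topspace ?BI" for \<omega>
    proof -
      show "path_start (h \<omega>) = path_start (fst \<omega>)" using G0[OF that] by (simp add: h_def)
      have "0 \<le> fst (fst \<omega>)" using wT(1) that by auto
      then show "path_end (h \<omega>) = path_end (fst \<omega>)"
        using Gend[OF that order_refl] by (simp add: h_def)
    qed
    have h0: "h (\<omega>, 0) = \<omega>" if "\<omega> \<in> topspace B" for \<omega>
      using wT(2)[OF that]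
      by (auto simp: h_def G_def f_def prod_eq_iff restrict_def extensional_def)
    have hA: "h \<omega> \<in> topspace A" if \<omega>: "\<omega> \<in> topspace \<Omega>" for \<omega>
    proof -
      have \<omega>': "\<omega> \<in> topspace ?BI" "fst \<omega> \<in> topspace B" "0 < snd \<omega>"
        using \<omega> \<Omega> by (cases \<omega>; auto)+
      \<comment> \<open>at positive times the path runs within \<open>X\<^sub>i\<close> to a point of \<open>Xb\<close>, hence within one path component\<close>
      have inXb: "G (\<omega>, t) \<in> Xb" if "0 < t" for t
      proof -
        have "(\<lambda>t. G (\<omega>, t)) ` {0<..} \<subseteq> Xb"
        proof (rule image_subset_path_component[where X = ?X and A = "?D i" and t = "fst (fst \<omega>)"])
          have "continuous_map half_line ?X (\<lambda>t. G (\<omega>, t))"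
            by (rule continuous_map_slice[OF G \<omega>'(1)])
          then show "continuous_map (top_of_set {0<..}) ?X (\<lambda>t. G (\<omega>, t))"
            by (rule continuous_map_from_subtopology_mono) auto
          show "path_connected {0::real<..}" by (simp add: convex_imp_path_connected)
          show "(\<lambda>t. G (\<omega>, t)) ` {0<..} \<subseteq> ?D i"
            using f'2 \<omega> \<omega>'(3) by (auto simp: G_def)
          show "fst (fst \<omega>) \<in> {0<..}" using Tpos[OF \<omega>'(2)] by simp
          show "G (\<omega>, fst (fst \<omega>)) \<in> Xb"
            using Gend[OF \<omega>'(1) order_refl] wB(3)[OF \<omega>'(2)] by simp
        qed (rule i(2))
        then show ?thesis using that by blast
      qed
      have "h \<omega> \<in> topspace (moore_path_space ?X)"
        using hm \<omega>'(1) by (auto simp: continuous_map_def)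
      moreover have "snd (h \<omega>) t \<in> Xb \<union> Xa" if "0 \<le> t" for t
        using that inXb[of t] G0[OF \<omega>'(1)] wB(2)[OF \<omega>'(2)] by (cases "t = 0") (auto simp: h_def)
      moreover have "0 < fst (h \<omega>)" using Tpos[OF \<omega>'(2)] by (simp add: h_def)
      moreover have "path_start (h \<omega>) \<in> Xa" using h_start[OF \<omega>'(1)] wB(2)[OF \<omega>'(2)] by simp
      moreover have "snd (h \<omega>) t \<in> topspace (subtopology ?X (Xb \<union> Xa)) - Xa" if "0 < t" for t
        using inXb[OF that] i(4) disj that by (auto simp: h_def)
      ultimately show ?thesis
        unfolding A_def topspace_holink mem_Collect_eq greaterThanAtMost_iff Ball_def by blast
    qed
    have "h \<omega> \<in> topspace B" if "\<omega> \<in> topspace ?BI" for \<omega>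
    proof (cases "0 < snd \<omega>")
      case True
      then have "\<omega> \<in> topspace \<Omega>" using that \<Omega> by auto
      then show ?thesis using hA AB(1) by blast
    next
      case False
      then have "\<omega> = (fst \<omega>, 0)" using that by (cases \<omega>) auto
      then show ?thesis using h0[of "fst \<omega>"] that by auto
    qed
    then have "continuous_map ?BI B h"
      using hm unfolding B_def pop_def subtopology_topspace continuous_map_in_subtopology
      by (auto simp: topspace_subtopology)
    then show ?thesis
      using h0 h_start h_end hA \<Omega> by (intro exI[of _ h]) auto
  qed
  then show ?thesis
    using AB(2) unfolding special_path_inclusion_def A_def B_def by blast
qed

end
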